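(* Let $\sigma:X^+\to X^+$, $\lambda$, $\varphi$, $r$, $\Theta$ be as in the context, and in particular assume there exist three points $x_1,x_2,x_3$ with $\sigma^{N'}(x_j)=x_j$ for a common $N'\in\mathbb{N}^+$, with $r_{N'}(x_2)\neq r_{N'}(x_3)$, such that $(\alpha',\beta')\in\mathbb{R}^{d+1}$, $$\alpha'=\frac{r_{N'}(x_1)-r_{N'}(x_2)}{r_{N'}(x_2)-r_{N'}(x_3)},\qquad \beta'=\frac1{2\pi}\big(\Theta_{N'}(x_1)-\Theta_{N'}(x_2)\big)-\frac{1}{2\pi}\alpha'\big(\Theta_{N'}(x_2)-\Theta_{N'}(x_3)\big),$$ is an inhomogeneous Diophantine number. Then there exist $C_2>0$, $C_3>0$ and $C_4>0$ such that for every $(b,m)\in\mathbb{R}\times\mathbb{Z}^d$ with $m\neq0$ and every $h\in F_\lambda(X^+)$, $$\big\|\mathcal{L}_{b,m}^{C_2\log b_m}h\big\|_{b_m}\le(1-b_m^{-C_3})\|h\|_{b_m},\qquad\text{where } \|h\|_{b_m}=\max\Big\{|h|_\infty,\frac{|h|_{Lip}}{C_4b_m}\Big\}.$$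
   Context: Symbolic setting: $A$ is an aperiodic $N\times N$ matrix of zeros and ones (some power is positive), $X^+=\{x=(x_i)_{i\ge0}\in\{1,\dots,N\}^{\mathbb{N}}:A(x_i,x_{i+1})=1\}$, $\sigma:X^+\to X^+$, $\sigma(x)_i=x_{i+1}$. For the metric constant $\lambda\in(0,1)$ (taken close to 1, in particular $\lambda\ge1/2$), $d_\lambda(x,y)=\lambda^{\min\{i:x_i\neq y_i\}}$. $F_\lambda(X^+)$ is the space of complex-valued Lipschitz functions on $(X^+,d_\lambda)$; $|\cdot|_{Lip}$ is the Lipschitz seminorm and $|\cdot|_\infty$ the supremum norm. The functions $r:X^+\to(0,\infty)$, $\Theta:X^+\to\mathbb{R}^d$ ($d\ge1$) and $\varphi:X^+\to\mathbb{R}$ are Lipschitz for $d_\lambda$, and $\varphi$ is normalized: $\mathcal{L}_\varphi1=1$, where for a function $\psi$, $\mathcal{L}_\psi h(x)=\sum_{\sigma(y)=x}e^{\psi(y)}h(y)$. For a function $\psi$, $\psi_n=\sum_{i=0}^{n-1}\psi\circ\sigma^i$. For $x,y\in\mathbb{R}^d$, $xy=\sum_ix_iy_i$ and $|x|=\sum_i|x_i|$. A point $(\alpha,\beta)\in\mathbb{R}\times\mathbb{R}^d$ is an inhomogeneous Diophantine number if there are $C,\gamma>0$ with $|q\alpha+m\beta-p|\ge C(|q|+|m|)^{-\gamma}$ for all $p\in\mathbb{Z}$ and all $(0,0)\ne(q,m)\in\mathbb{Z}\times\mathbb{Z}^d$. For $b\in\mathbb{R}$ and $0\ne m\in\mathbb{Z}^d$: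 $b_m=|b|+C_1|m|$, where $C_1\ge1$ is a fixed constant taken sufficiently large (depending only on the data $X^+,\lambda,\varphi,r,\Theta$), so that all $b_m$ are sufficiently large; and $\mathcal{L}_{b,m}=\mathcal{L}_{\varphi-ibr+im\Theta}$. Non-integer iterates such as $C_2\log b_m$ are understood as rounded down to an integer. *)

theory Defs
  imports "HOL-Analysis.Analysis"
begin

text \<open>
  The alphabet \<open>{1, \<dots>, N}\<close> is a finite type \<open>'k\<close> with \<open>CARD('k) = N\<close>, and the index set of
  \<open>\<real>\<^sup>d\<close> is a finite type \<open>'d\<close>. Functions on the shift space are total functions on all sequences;
  every notion below only inspects their values on \<open>subshift A\<close>.
\<close>

definition mat_pow :: "nat^'k^'k \<Rightarrow> nat \<Rightarrow> nat^'k^'k" where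
  "mat_pow A n = (((**) A) ^^ n) (mat 1)"

definition zero_one_matrix :: "nat^'k^'k \<Rightarrow> bool" where
  "zero_one_matrix A \<longleftrightarrow> (\<forall>i j. A $ i $ j \<in> {0, 1})"

definition aperiodic :: "nat^'k^'k \<Rightarrow> bool" where
  "aperiodic A \<longleftrightarrow> (\<exists>n>0. \<forall>i j. mat_pow A n $ i $ j > 0)"

definition subshift :: "nat^'k^'k \<Rightarrow> (nat \<Rightarrow> 'k) set" where
  "subshift A = {x. \<forall>i. A $ x i $ x (Suc i) = 1}"

definition left_shift :: "(nat \<Rightarrow> 'k) \<Rightarrow> nat \<Rightarrow> 'k" where
  "left_shift x = (\<lambda>i. x (Suc i))"

definition shift_dist :: "real \<Rightarrow> (nat \<Rightarrow> 'k) \<Rightarrow> (nat \<Rightarrow> 'k) \<Rightarrow> real" where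
  "shift_dist l x y = (if x = y then 0 else l ^ (LEAST i. x i \<noteq> y i))"

definition shift_metric :: "nat^'k^'k \<Rightarrow> real \<Rightarrow> (nat \<Rightarrow> 'k) metric" where
  "shift_metric A l = metric (subshift A, shift_dist l)"

lemma Metric_space_shift_dist:
  assumes "0 < l" "l < 1"
  shows "Metric_space M (shift_dist l)"
proof
  fix x y z :: "nat \<Rightarrow> 'a"
  show "0 \<le> shift_dist l x y"
    using assms by (simp add: shift_dist_def)
  show "shift_dist l x y = shift_dist l y x"
  proof -
    have "(\<lambda>i. x i \<noteq> y i) = (\<lambda>i. y i \<noteq> x i)" by metis
    then show ?thesis unfolding shift_dist_def by (cases "x = y") auto
  qed
  show "shift_dist l x y = 0 \<longleftrightarrow> x = y"
    using assms by (simp add: shift_dist_def)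
  show "shift_dist l x z \<le> shift_dist l x y + shift_dist l y z"
  proof (cases "x = y \<or> y = z \<or> x = z")
    case True
    then show ?thesis using assms by (auto simp: shift_dist_def)
  next
    case False
    let ?k = "LEAST i. x i \<noteq> z i"
    have "x ?k \<noteq> z ?k"
    proof (rule LeastI_ex)
      show "\<exists>i. x i \<noteq> z i" using False by (auto simp: fun_eq_iff)
    qed
    then have "x ?k \<noteq> y ?k \<or> y ?k \<noteq> z ?k" by auto
    then have "(LEAST i. x i \<noteq> y i) \<le> ?k \<or> (LEAST i. y i \<noteq> z i) \<le> ?k"
      by (blast intro: Least_le)
    then have "l ^ ?k \<le> l ^ (LEAST i. x i \<noteq> y i) \<or> l ^ ?k \<le> l ^ (LEAST i. y i \<noteq> z i)"
      using assms power_decreasing[of _ _ l] by (meson less_eq_real_def)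
    moreover have "0 \<le> l ^ (LEAST i. x i \<noteq> y i)" "0 \<le> l ^ (LEAST i. y i \<noteq> z i)"
      using assms by auto
    ultimately show ?thesis using False unfolding shift_dist_def by auto
  qed
qed

lemma mspace_shift_metric:
  "0 < l \<Longrightarrow> l < 1 \<Longrightarrow> mspace (shift_metric A l) = subshift A"
  by (simp add: shift_metric_def Metric_space.mspace_metric Metric_space_shift_dist)

lemma mdist_shift_metric:
  "0 < l \<Longrightarrow> l < 1 \<Longrightarrow> mdist (shift_metric A l) = shift_dist l"
  by (simp add: shift_metric_def Metric_space.mdist_metric Metric_space_shift_dist)

text \<open>
  For values in \<open>real^'d\<close> the Lipschitz condition is taken in the Euclidean norm; as all norms on
  \<open>\<real>\<^sup>d\<close> are equivalent, this is the same condition as for the norm \<open>\<Sum>\<^sub>i \<bar>x\<^sub>i\<bar>\<close>.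
\<close>

definition shift_Lipschitz ::
    "nat^'k^'k \<Rightarrow> real \<Rightarrow> ((nat \<Rightarrow> 'k) \<Rightarrow> 'b::real_normed_vector) \<Rightarrow> bool" where
  "shift_Lipschitz A l f \<longleftrightarrow> Lipschitz_continuous_map (shift_metric A l) euclidean_metric f"

definition Lip_space :: "nat^'k^'k \<Rightarrow> real \<Rightarrow> ((nat \<Rightarrow> 'k) \<Rightarrow> complex) set" where
  "Lip_space A l = {h. shift_Lipschitz A l h}"

definition sup_norm :: "nat^'k^'k \<Rightarrow> ((nat \<Rightarrow> 'k) \<Rightarrow> complex) \<Rightarrow> real" where
  "sup_norm A h = (SUP x\<in>subshift A. norm (h x))"

text \<open>
  Diagonal pairs contribute \<open>0 / 0 = 0\<close>; they keep the supremum over a nonempty set.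
\<close>

definition Lip_seminorm :: "nat^'k^'k \<Rightarrow> real \<Rightarrow> ((nat \<Rightarrow> 'k) \<Rightarrow> complex) \<Rightarrow> real" where
  "Lip_seminorm A l h =
     (SUP (x, y)\<in>subshift A \<times> subshift A. norm (h x - h y) / shift_dist l x y)"

definition transfer_op ::
    "nat^'k^'k \<Rightarrow> ((nat \<Rightarrow> 'k) \<Rightarrow> complex) \<Rightarrow> ((nat \<Rightarrow> 'k) \<Rightarrow> complex) \<Rightarrow> (nat \<Rightarrow> 'k) \<Rightarrow> complex"
  where
  "transfer_op A \<psi> h x = (\<Sum>y | y \<in> subshift A \<and> left_shift y = x. exp (\<psi> y) * h y)"

definition birkhoff_sum ::
    "((nat \<Rightarrow> 'k) \<Rightarrow> 'b::comm_monoid_add) \<Rightarrow> nat \<Rightarrow> (nat \<Rightarrow> 'k) \<Rightarrow> 'b" where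
  "birkhoff_sum \<psi> n x = (\<Sum>i<n. \<psi> ((left_shift ^^ i) x))"

definition int_l1 :: "int^'d \<Rightarrow> real" where
  "int_l1 m = (\<Sum>i\<in>UNIV. \<bar>of_int (m $ i)\<bar>)"

definition int_dot :: "int^'d \<Rightarrow> real^'d \<Rightarrow> real" where
  "int_dot m x = (\<Sum>i\<in>UNIV. of_int (m $ i) * x $ i)"

definition inhom_diophantine :: "real \<Rightarrow> real^'d \<Rightarrow> bool" where
  "inhom_diophantine \<alpha> \<beta> \<longleftrightarrow>
     (\<exists>C>0. \<exists>\<gamma>>0. \<forall>(p::int) (q::int) (m::int^'d). (q, m) \<noteq> (0, 0) \<longrightarrow>
        \<bar>of_int q * \<alpha> + int_dot m \<beta> - of_int p\<bar> \<ge> C * (\<bar>of_int q\<bar> + int_l1 m) powr (- \<gamma>))"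

definition b_weight :: "real \<Rightarrow> real \<Rightarrow> int^'d \<Rightarrow> real" where
  "b_weight C1 b m = \<bar>b\<bar> + C1 * int_l1 m"

definition twisted_op ::
    "nat^'k^'k \<Rightarrow> ((nat \<Rightarrow> 'k) \<Rightarrow> real) \<Rightarrow> ((nat \<Rightarrow> 'k) \<Rightarrow> real) \<Rightarrow> ((nat \<Rightarrow> 'k) \<Rightarrow> real^'d) \<Rightarrow>
     real \<Rightarrow> int^'d \<Rightarrow> ((nat \<Rightarrow> 'k) \<Rightarrow> complex) \<Rightarrow> (nat \<Rightarrow> 'k) \<Rightarrow> complex" where
  "twisted_op A \<phi> r \<Theta> b m =
     transfer_op A (\<lambda>x. of_real (\<phi> x) - \<i> * of_real (b * r x) + \<i> * of_real (int_dot m (\<Theta> x)))"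

text \<open>The norm \<open>\<parallel>h\<parallel>\<^bsub>B\<^esub>\<close>, where \<open>B\<close> stands for \<open>b\<^sub>m\<close>.\<close>

definition weighted_norm ::
    "nat^'k^'k \<Rightarrow> real \<Rightarrow> real \<Rightarrow> real \<Rightarrow> ((nat \<Rightarrow> 'k) \<Rightarrow> complex) \<Rightarrow> real" where
  "weighted_norm A l C4 B h = max (sup_norm A h) (Lip_seminorm A l h / (C4 * B))"

end

theory Submission
  imports Defs
begin

text \<open>
  The proof is by contradiction. After \<open>n \<approx> C2 ln B\<close> steps, where \<open>B = b_weight C1 b m\<close>, the
  Lipschitz part of the norm has contracted by the Lasota--Yorke inequality, so a failure of the
  estimate means that \<open>\<bar>T\<^sup>n h\<bar>\<close> comes within \<open>\<epsilon> = B\<^bsup>-C3\<^esup>\<close> of \<open>1\<close> at some \<open>x\<close>, for a function \<open>h\<close> of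
  norm \<open>1\<close>. As \<open>T\<^sup>n h (x)\<close> is a convex combination of the unimodular multiples \<open>cis (\<omega>\<^sub>n y) h y\<close> over
  the preimages \<open>y\<close> of \<open>x\<close>, with weights at least \<open>exp (- \<Phi> n)\<close>, all these terms are close to
  \<open>T\<^sup>n h (x)\<close>. Preimages become dense, so all earlier iterates are nearly unimodular everywhere and
  the ratio of \<open>T\<^sup>s h\<close> to \<open>T\<^bsup>s-q\<^esup> h\<close> is nearly the same constant at all points. At a point of period
  \<open>q\<close> this ratio is nearly \<open>cis (\<omega>\<^sub>q x)\<close>, hence the phases \<open>\<omega>\<^sub>q = - b r\<^sub>q + m \<Theta>\<^sub>q\<close> at the three
  periodic points agree modulo \<open>2\<pi>\<close> up to a large negative power of \<open>B\<close>. Eliminating \<open>b\<close>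
  contradicts the Diophantine condition.
\<close>

subsection \<open>Shift spaces and iterated transfer operators\<close>

lemma funpow_left_shift: "(left_shift ^^ n) x = (\<lambda>i. x (i + n))"
  by (induction n) (auto simp: left_shift_def)

lemma funpow_left_shift_in_subshift: "x \<in> subshift A \<Longrightarrow> (left_shift ^^ n) x \<in> subshift A"
  by (simp add: funpow_left_shift subshift_def)

definition preimages :: "nat^'k^'k \<Rightarrow> nat \<Rightarrow> (nat \<Rightarrow> 'k) \<Rightarrow> (nat \<Rightarrow> 'k) set" where
  "preimages A n x = {y \<in> subshift A. (left_shift ^^ n) y = x}"

lemma preimages_subset: "y \<in> preimages A n x \<Longrightarrow> y \<in> subshift A"
  by (simp add: preimages_def)

text \<open>Indexing by the prepended letter allows the preimages of two points with the same first
  letter to be paired in \<open>lip_bounded_T\<close>.\<close>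

lemma preimages_1_eq:
  fixes x :: "nat \<Rightarrow> 'k::finite"
  shows "preimages A 1 x = (\<lambda>a. case_nat a x) ` {a. case_nat a x \<in> subshift A}"
proof -
  have "y = case_nat (y 0) x" if "left_shift y = x" for y :: "nat \<Rightarrow> 'k"
    using that by (auto simp: left_shift_def split: nat.split)
  then have "y \<in> (\<lambda>a. case_nat a x) ` {a. case_nat a x \<in> subshift A}" if "y \<in> preimages A 1 x" for y
    using that unfolding preimages_def by (intro image_eqI[where x = "y 0"]) auto
  then show ?thesis
    by (auto simp: preimages_def left_shift_def)
qed

lemma finite_preimages:
  fixes A :: "nat^'k::finite^'k"
  shows "finite (preimages A n x)"
proof (induction n)
  case 0
  have "preimages A 0 x \<subseteq> {x}" by (auto simp: preimages_def)
  then show ?case by (rule finite_subset) simp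
next
  case (Suc n)
  have "preimages A (Suc n) x \<subseteq> (\<lambda>(a, z). case_nat a z) ` (UNIV \<times> preimages A n x)"
  proof
    fix y assume y: "y \<in> preimages A (Suc n) x"
    then have "left_shift y \<in> preimages A n x"
      using funpow_left_shift_in_subshift[of y A 1]
      by (simp add: preimages_def funpow_left_shift left_shift_def fun_eq_iff)
    moreover have "y = case_nat (y 0) (left_shift y)"
      by (auto simp: left_shift_def split: nat.split)
    ultimately show "y \<in> (\<lambda>(a, z). case_nat a z) ` (UNIV \<times> preimages A n x)"
      by (intro image_eqI[where x = "(y 0, left_shift y)"]) auto
  qed
  then show ?case by (rule finite_subset) (use Suc in auto)
qed

lemma transfer_op_preimages:
  "transfer_op A \<psi> h x = (\<Sum>y\<in>preimages A 1 x. exp (\<psi> y) * h y)"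
  by (simp add: transfer_op_def preimages_def)

text \<open>The preimages of order \<open>Suc n\<close> are grouped by their image under
  \<open>left_shift ^^ n\<close>.\<close>

lemma sum_preimages_Suc:
  fixes A :: "nat^'k::finite^'k"
  shows "(\<Sum>z\<in>preimages A 1 x. \<Sum>y\<in>preimages A n z. f y) = (\<Sum>y\<in>preimages A (Suc n) x. f y)"
proof -
  have "{y \<in> preimages A (Suc n) x. (left_shift ^^ n) y = z} = preimages A n z"
    if "z \<in> preimages A 1 x" for z
    using that by (auto simp: preimages_def)
  moreover have "(left_shift ^^ n) ` preimages A (Suc n) x \<subseteq> preimages A 1 x"
    by (auto simp: preimages_def funpow_left_shift_in_subshift)
  ultimately show ?thesis
    using sum.group[of "preimages A (Suc n) x" "preimages A 1 x" "left_shift ^^ n" f]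
    by (simp add: finite_preimages)
qed

lemma funpow_transfer_op:
  fixes A :: "nat^'k::finite^'k"
  assumes "x \<in> subshift A"
  shows "(transfer_op A \<psi> ^^ n) h x = (\<Sum>y\<in>preimages A n x. exp (birkhoff_sum \<psi> n y) * h y)"
  using assms
proof (induction n arbitrary: x)
  case 0
  then have "preimages A 0 x = {x}" by (auto simp: preimages_def)
  then show ?case by (simp add: birkhoff_sum_def)
next
  case (Suc n)
  have "(transfer_op A \<psi> ^^ Suc n) h x =
      (\<Sum>z\<in>preimages A 1 x. exp (\<psi> z) * (transfer_op A \<psi> ^^ n) h z)"
    by (simp add: transfer_op_preimages)
  also have "\<dots> = (\<Sum>z\<in>preimages A 1 x. \<Sum>y\<in>preimages A n z. exp (birkhoff_sum \<psi> (Suc n) y) * h y)"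
  proof (rule sum.cong[OF refl])
    fix z assume "z \<in> preimages A 1 x"
    then have "z \<in> subshift A" by (rule preimages_subset)
    then show "exp (\<psi> z) * (transfer_op A \<psi> ^^ n) h z =
        (\<Sum>y\<in>preimages A n z. exp (birkhoff_sum \<psi> (Suc n) y) * h y)"
      by (simp add: Suc.IH sum_distrib_left)
        (auto simp: birkhoff_sum_def preimages_def exp_add mult_ac intro!: sum.cong)
  qed
  also have "\<dots> = (\<Sum>y\<in>preimages A (Suc n) x. exp (birkhoff_sum \<psi> (Suc n) y) * h y)"
    by (rule sum_preimages_Suc)
  finally show ?case .
qed

lemma funpow_transfer_op_scale:
  fixes A :: "nat^'k::finite^'k"
  assumes "x \<in> subshift A"
  shows "(transfer_op A \<psi> ^^ n) (\<lambda>y. c * h y) x = c * (transfer_op A \<psi> ^^ n) h x"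
  using assms by (simp add: funpow_transfer_op sum_distrib_left mult_ac)

section \<open>Distances between one-sided sequences\<close>

lemma shift_dist_le_power:
  assumes "0 < l" "l < 1" "\<And>i. i < n \<Longrightarrow> x i = y i"
  shows "shift_dist l x y \<le> l ^ n"
proof (cases "x = y")
  case True
  then show ?thesis using assms by (simp add: shift_dist_def)
next
  case False
  then have "\<exists>i. x i \<noteq> y i" by auto
  then have "x (LEAST i. x i \<noteq> y i) \<noteq> y (LEAST i. x i \<noteq> y i)" by (rule LeastI_ex)
  then have "n \<le> (LEAST i. x i \<noteq> y i)" using assms(3) by (meson not_le)
  then show ?thesis
    using False assms by (simp add: shift_dist_def power_decreasing)
qed

lemma shift_dist_eq_1: "x 0 \<noteq> y 0 \<Longrightarrow> shift_dist l x y = 1"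
  by (auto simp: shift_dist_def Least_eq_0)

lemma shift_dist_case_nat:
  assumes "0 < l"
  shows "shift_dist l (case_nat a x) (case_nat a y) = l * shift_dist l x y"
proof (cases "x = y")
  case True
  then show ?thesis by (simp add: shift_dist_def)
next
  case False
  then obtain i where i: "x i \<noteq> y i" by auto
  have "case_nat a x \<noteq> case_nat a y" using i by (auto simp: fun_eq_iff intro!: exI[of _ "Suc i"])
  moreover have "(LEAST j. case_nat a x j \<noteq> case_nat a y j) = Suc (LEAST j. x j \<noteq> y j)"
    using i by (subst Least_Suc[of _ "Suc i"]) auto
  ultimately show ?thesis using False by (simp add: shift_dist_def)
qed

lemma shift_dist_nonneg: "0 < l \<Longrightarrow> 0 \<le> shift_dist l x y"
  by (simp add: shift_dist_def)

lemma shift_dist_le_1: "0 < l \<Longrightarrow> l < 1 \<Longrightarrow> shift_dist l x y \<le> 1"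
  using shift_dist_le_power[of l 0 x y] by simp

lemma shift_dist_pos: "0 < l \<Longrightarrow> x \<noteq> y \<Longrightarrow> 0 < shift_dist l x y"
  by (simp add: shift_dist_def)

section \<open>Connecting words and density of preimages\<close>

lemma mat_pow_path:
  fixes A :: "nat^'k::finite^'k"
  assumes "zero_one_matrix A" "mat_pow A n $ i $ j > 0"
  shows "\<exists>w. w 0 = i \<and> w n = j \<and> (\<forall>k<n. A $ w k $ w (Suc k) = 1)"
  using assms(2)
proof (induction n arbitrary: i)
  case 0
  then have "i = j" by (auto simp: mat_pow_def mat_def split: if_splits)
  then show ?case by (intro exI[of _ "\<lambda>_. i"]) auto
next
  case (Suc n)
  have "(\<Sum>k\<in>UNIV. A $ i $ k * mat_pow A n $ k $ j) > 0"
    using Suc.prems by (simp add: mat_pow_def matrix_matrix_mult_def)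
  then obtain k where "A $ i $ k * mat_pow A n $ k $ j > 0"
    by (metis (no_types, lifting) neq0_conv sum.neutral)
  then have k: "A $ i $ k > 0" "mat_pow A n $ k $ j > 0" by auto
  have "A $ i $ k = 1"
    using k(1) assms(1) unfolding zero_one_matrix_def by (metis insertE neq0_conv singletonD)
  moreover obtain w where "w 0 = k" "w n = j" "\<forall>k<n. A $ w k $ w (Suc k) = 1"
    using Suc.IH k(2) by blast
  ultimately show ?case
    by (intro exI[of _ "case_nat i w"]) (auto simp: less_Suc_eq_0_disj)
qed

text \<open>Aperiodicity in the form used below: one length \<open>p\<close> serves all pairs of
  letters, so density of preimages is uniform in the points.\<close>

definition connecting_gap :: "nat^'k^'k \<Rightarrow> nat \<Rightarrow> bool" where
  "connecting_gap A p \<longleftrightarrow> (\<forall>i j. \<exists>w. w 0 = i \<and> w p = j \<and> (\<forall>k<p. A $ w k $ w (Suc k) = 1))"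

lemma aperiodic_connecting_gap:
  fixes A :: "nat^'k::finite^'k"
  assumes "zero_one_matrix A" "aperiodic A"
  shows "\<exists>p. connecting_gap A p"
  using assms mat_pow_path unfolding aperiodic_def connecting_gap_def by blast

text \<open>The first \<open>t - p\<close> letters of \<open>z\<close>, a connecting word of length
  \<open>p\<close> and then \<open>x\<close> form the required preimage.\<close>

lemma preimages_dense:
  assumes "0 < l" "l < 1" "connecting_gap A p" "x \<in> subshift A" "z \<in> subshift A" "p \<le> t"
  shows "\<exists>y\<in>preimages A t x. shift_dist l y z \<le> l ^ (t - p)"
proof -
  obtain w where w: "w 0 = z (t - p)" "w p = x 0" "\<forall>k<p. A $ w k $ w (Suc k) = 1"
    using assms(3) unfolding connecting_gap_def by meson
  define y where "y i = (if i < t - p then z i else if i < t then w (i - (t - p)) else x (i - t))" for i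
  have "A $ y i $ y (Suc i) = 1" for i
  proof -
    consider "Suc i < t - p" | "Suc i = t - p" | "t - p \<le> i" "Suc i < t" | "t - p \<le> i" "Suc i = t" | "t \<le> i"
      by linarith
    then show ?thesis
    proof cases
      case 1
      then show ?thesis using assms(5) by (simp add: y_def subshift_def)
    next
      case 2
      have "y i = z i" using 2 by (simp add: y_def)
      \<comment> \<open>At this seam the letter is \<open>w 0 = z (t - p)\<close>; for
        \<open>p = 0\<close> it is \<open>x 0\<close>, which equals \<open>w 0\<close> as
        well.\<close>
      moreover have "y (Suc i) = z (Suc i)"
        using 2 w(1,2) assms(6) by (cases "p = 0") (auto simp: y_def)
      ultimately show ?thesis using assms(5) by (simp add: subshift_def)
    next
      case 3
      then have "y i = w (i - (t - p))" "y (Suc i) = w (Suc (i - (t - p)))"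
        by (auto simp: y_def Suc_diff_le)
      moreover have "i - (t - p) < p" using 3 by linarith
      ultimately show ?thesis using w(3) by simp
    next
      case 4
      then have "y i = w (i - (t - p))" "y (Suc i) = w (Suc (i - (t - p)))"
        using w(2) assms(6) by (auto simp: y_def Suc_diff_le[symmetric])
      moreover have "i - (t - p) < p" using 4 assms(6) by linarith
      ultimately show ?thesis using w(3) by simp
    next
      case 5
      then show ?thesis using assms(4) by (auto simp: y_def subshift_def Suc_diff_le)
    qed
  qed
  then have "y \<in> subshift A" by (simp add: subshift_def)
  moreover have "(left_shift ^^ t) y = x"
  proof -
    have "\<not> i + t < t - p" for i by linarith
    then show ?thesis by (simp add: funpow_left_shift y_def)
  qed
  moreover have "shift_dist l y z \<le> l ^ (t - p)"
    by (rule shift_dist_le_power) (use assms in \<open>auto simp: y_def\<close>)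
  ultimately show ?thesis by (auto simp: preimages_def)
qed

subsection \<open>Normalized twisted transfer operators\<close>

text \<open>The derivative of \<open>exp\<close> has modulus at most 1 on the convex left
  half-plane, where \<open>\<phi>_nonpos\<close> places the values of \<open>\<psi>\<close>.\<close>

lemma norm_exp_diff_le:
  fixes u v :: complex
  assumes "Re u \<le> 0" "Re v \<le> 0"
  shows "norm (exp u - exp v) \<le> norm (u - v)"
proof -
  have "norm (exp u - exp v) \<le> 1 * norm (u - v)"
    by (rule field_differentiable_bound[where S = "{z. Re z \<le> 0}" and f' = exp])
      (use assms in \<open>auto simp: convex_halfspace_Re_le intro!: derivative_eq_intros\<close>)
  then show ?thesis by simp
qed

text \<open>
  The left-hand side is at most the \<open>p\<close>-variance of \<open>u\<close>, which is the mean of \<open>\<bar>u\<bar>\<^sup>2\<close> minus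
  the squared norm of the mean.
\<close>
lemma convex_combination_near_sphere:
  fixes u :: "'a \<Rightarrow> 'b::real_inner"
  assumes "finite S" "\<And>y. y \<in> S \<Longrightarrow> 0 \<le> p y" "sum p S = 1" "\<And>y. y \<in> S \<Longrightarrow> norm (u y) \<le> 1"
    and c: "c = (\<Sum>y\<in>S. p y *\<^sub>R u y)" and "1 - \<epsilon> \<le> norm c" "0 \<le> \<epsilon>" "y \<in> S"
  shows "p y * (norm (u y - c))\<^sup>2 \<le> 2 * \<epsilon>"
proof -
  have "p y * (norm (u y - c))\<^sup>2 \<le> (\<Sum>y\<in>S. p y * (norm (u y - c))\<^sup>2)"
    using assms by (intro member_le_sum) auto
  also have "\<dots> = (\<Sum>y\<in>S. p y * (norm (u y))\<^sup>2 - 2 * ((p y *\<^sub>R u y) \<bullet> c) + p y * (c \<bullet> c))"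
    by (rule sum.cong)
      (auto simp: power2_norm_eq_inner inner_diff_left inner_diff_right inner_commute algebra_simps)
  also have "\<dots> = (\<Sum>y\<in>S. p y * (norm (u y))\<^sup>2) - 2 * (c \<bullet> c) + c \<bullet> c"
    using \<open>sum p S = 1\<close> unfolding c
    by (simp only: sum.distrib sum_subtractf inner_sum_left sum_distrib_left[symmetric]
        sum_distrib_right[symmetric] mult_1)
  also have "\<dots> = (\<Sum>y\<in>S. p y * (norm (u y))\<^sup>2) - (norm c)\<^sup>2"
    by (simp add: power2_norm_eq_inner)
  also have "(\<Sum>y\<in>S. p y * (norm (u y))\<^sup>2) \<le> (\<Sum>y\<in>S. p y * 1)"
    by (intro sum_mono mult_left_mono) (use assms in \<open>auto simp: power_le_one\<close>)
  also have "(\<Sum>y\<in>S. p y * 1) - (norm c)\<^sup>2 = 1 - (norm c)\<^sup>2"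
    using assms by simp
  also have "\<dots> \<le> 2 * \<epsilon>"
  \<comment> \<open>Squaring the lower bound on \<open>norm c\<close> needs
    \<open>1 - \<epsilon>\<close> nonnegative; otherwise \<open>2 * \<epsilon>\<close> exceeds 1
    anyway.\<close>
  proof (cases "\<epsilon> \<le> 1")
    case True
    then have "(1 - \<epsilon>)\<^sup>2 \<le> (norm c)\<^sup>2"
      using assms by (intro power_mono) auto
    moreover have "(1 - \<epsilon>)\<^sup>2 = 1 - 2 * \<epsilon> + \<epsilon>\<^sup>2"
      by (simp add: power2_eq_square algebra_simps)
    ultimately show ?thesis using zero_le_power2[of \<epsilon>] by linarith
  next
    case False
    then show ?thesis using zero_le_power2[of "norm c"] by linarith
  qed
  finally show ?thesis by simp
qed

text \<open>An exact decomposition into three terms of size \<open>\<eta>\<close> and two of size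
  \<open>\<delta>\<close>, as \<open>F\<close> and \<open>E\<close> are rotations. In the
  application \<open>F\<close> is the phase along a deep preimage and \<open>E\<close> the phase
  along a periodic orbit.\<close>

lemma norm_diff_rotation_le:
  fixes a b u v :: complex
  assumes "norm F = 1" "norm E = 1"
    and "norm (F * u - a) \<le> \<eta>" "norm (F * u' - a') \<le> \<eta>" "norm (E * v' - v) \<le> \<eta>"
    and "norm (u - v) \<le> \<delta>" "norm (u' - v') \<le> \<delta>"
  shows "norm (a - E * a') \<le> 3 * \<eta> + 2 * \<delta>"
proof -
  have "a - E * a' = - (F * u - a) + F * (u - v) - F * (E * v' - v)
      - F * E * (u' - v') + E * (F * u' - a')"
    by (simp add: algebra_simps)
  also have "norm \<dots> \<le> \<eta> + \<delta> + \<eta> + \<delta> + \<eta>"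
    by (intro norm_triangle_le norm_triangle_le_diff add_mono)
      (simp_all only: norm_minus_cancel norm_mult mult_1 assms)
  finally show ?thesis by simp
qed

text \<open>Explicit bounds instead of \<open>sup_norm\<close> and \<open>Lip_seminorm\<close>, so
  that suprema matter only when passing to and from \<open>weighted_norm\<close>.\<close>

definition lip_bounded ::
    "nat^'k^'k \<Rightarrow> real \<Rightarrow> ((nat \<Rightarrow> 'k) \<Rightarrow> complex) \<Rightarrow> real \<Rightarrow> real \<Rightarrow> bool" where
  "lip_bounded A l h S D \<longleftrightarrow>
     (\<forall>x\<in>subshift A. norm (h x) \<le> S) \<and>
     (\<forall>x\<in>subshift A. \<forall>y\<in>subshift A. norm (h x - h y) \<le> D * shift_dist l x y)"

lemma lip_bounded_mono:
  assumes "lip_bounded A l h S D" "0 < l" "S \<le> S'" "D \<le> D'"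
  shows "lip_bounded A l h S' D'"
  using assms shift_dist_nonneg[of l] unfolding lip_bounded_def
  by (meson order_trans mult_right_mono)

text \<open>The phase \<open>\<omega>\<close> abstracts from \<open>b\<close>, \<open>m\<close>,
  \<open>r\<close> and \<open>\<Theta>\<close>. In the application only \<open>Q\<close> grows with
  \<open>b\<close> and \<open>m\<close>; \<open>\<Phi>\<close> does not, which keeps the lower bound
  on the weights uniform.\<close>

locale twisted_shift =
  fixes A :: "nat^'k::finite^'k" and l :: real and \<phi> \<omega> :: "(nat \<Rightarrow> 'k) \<Rightarrow> real" and \<Phi> Q :: real
  assumes l_pos: "0 < l" and l_less_1: "l < 1"
    and \<Phi>_nonneg: "0 \<le> \<Phi>" and Q_nonneg: "0 \<le> Q"
    and normalized:
      "\<And>x. x \<in> subshift A \<Longrightarrow> transfer_op A (\<lambda>y. of_real (\<phi> y)) (\<lambda>y. 1) x = 1"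
    and \<phi>_ge: "\<And>x. x \<in> subshift A \<Longrightarrow> - \<Phi> \<le> \<phi> x"
    and \<phi>_Lipschitz: "\<And>x y. x \<in> subshift A \<Longrightarrow> y \<in> subshift A \<Longrightarrow>
      \<bar>\<phi> x - \<phi> y\<bar> \<le> Q * shift_dist l x y"
    and \<omega>_Lipschitz: "\<And>x y. x \<in> subshift A \<Longrightarrow> y \<in> subshift A \<Longrightarrow>
      \<bar>\<omega> x - \<omega> y\<bar> \<le> Q * shift_dist l x y"
begin

definition \<psi> :: "(nat \<Rightarrow> 'k) \<Rightarrow> complex" where
  "\<psi> x = of_real (\<phi> x) + \<i> * of_real (\<omega> x)"

abbreviation T :: "((nat \<Rightarrow> 'k) \<Rightarrow> complex) \<Rightarrow> (nat \<Rightarrow> 'k) \<Rightarrow> complex" where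
  "T \<equiv> transfer_op A \<psi>"

definition weight :: "nat \<Rightarrow> (nat \<Rightarrow> 'k) \<Rightarrow> real" where
  "weight n y = exp (birkhoff_sum \<phi> n y)"

lemma weight_pos: "0 < weight n y"
  by (simp add: weight_def)

text \<open>The normalization passes to iterates by induction, so each iterate of \<open>T\<close>
  is a convex combination of rotated values, as \<open>funpow_T\<close> displays.\<close>

lemma sum_weight: "x \<in> subshift A \<Longrightarrow> (\<Sum>y\<in>preimages A n x. weight n y) = 1"
proof (induction n arbitrary: x)
  case 0
  then have "preimages A 0 x = {x}" by (auto simp: preimages_def)
  then show ?case by (simp add: birkhoff_sum_def weight_def)
next
  case (Suc n)
  have "(\<Sum>y\<in>preimages A (Suc n) x. weight (Suc n) y) =
      (\<Sum>z\<in>preimages A 1 x. \<Sum>y\<in>preimages A n z. weight (Suc n) y)"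
    by (rule sum_preimages_Suc[symmetric])
  also have "\<dots> = (\<Sum>z\<in>preimages A 1 x. exp (\<phi> z))"
  proof (rule sum.cong[OF refl])
    fix z assume "z \<in> preimages A 1 x"
    then have z: "z \<in> subshift A" by (rule preimages_subset)
    have "(\<Sum>y\<in>preimages A n z. weight (Suc n) y) = (\<Sum>y\<in>preimages A n z. exp (\<phi> z) * weight n y)"
      by (auto simp: birkhoff_sum_def preimages_def exp_add weight_def mult_ac intro!: sum.cong)
    then show "(\<Sum>y\<in>preimages A n z. weight (Suc n) y) = exp (\<phi> z)"
      using Suc.IH[OF z] by (simp add: sum_distrib_left[symmetric])
  qed
  also have "\<dots> = 1"
  proof -
    have "complex_of_real (\<Sum>z\<in>preimages A 1 x. exp (\<phi> z)) = 1"
      using normalized[OF Suc.prems] by (simp add: transfer_op_preimages exp_of_real)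
    then show ?thesis using of_real_eq_1_iff by blast
  qed
  finally show ?case .
qed

text \<open>Each weight is one of the positive summands of a sum equal to 1.\<close>

lemma \<phi>_nonpos: "x \<in> subshift A \<Longrightarrow> \<phi> x \<le> 0"
proof -
  assume x: "x \<in> subshift A"
  then have "x \<in> preimages A 1 (left_shift x)" by (simp add: preimages_def)
  then have "weight 1 x \<le> (\<Sum>y\<in>preimages A 1 (left_shift x). weight 1 y)"
    by (intro member_le_sum) (auto simp: finite_preimages less_imp_le[OF weight_pos])
  also have "\<dots> = 1"
    using sum_weight[of "left_shift x" 1] funpow_left_shift_in_subshift[OF x, of 1] by simp
  finally show "\<phi> x \<le> 0" by (simp add: weight_def birkhoff_sum_def)
qed

lemma weight_ge: "y \<in> subshift A \<Longrightarrow> exp (- (\<Phi> * n)) \<le> weight n y"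
proof -
  assume y: "y \<in> subshift A"
  have "(\<Sum>i<n. - \<Phi>) \<le> birkhoff_sum \<phi> n y"
    unfolding birkhoff_sum_def
    by (intro sum_mono \<phi>_ge funpow_left_shift_in_subshift y)
  then show ?thesis by (simp add: weight_def mult.commute)
qed

lemma exp_birkhoff_sum_\<psi>:
  "exp (birkhoff_sum \<psi> n y) = of_real (weight n y) * cis (birkhoff_sum \<omega> n y)"
proof -
  have "birkhoff_sum \<psi> n y =
      of_real (birkhoff_sum \<phi> n y) + \<i> * of_real (birkhoff_sum \<omega> n y)"
    by (simp add: birkhoff_sum_def \<psi>_def sum.distrib sum_distrib_left)
  then show ?thesis by (simp add: exp_add weight_def exp_of_real cis_conv_exp)
qed

lemma funpow_T:
  "x \<in> subshift A \<Longrightarrow>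
    (T ^^ n) h x = (\<Sum>y\<in>preimages A n x. weight n y *\<^sub>R (cis (birkhoff_sum \<omega> n y) * h y))"
  by (simp add: funpow_transfer_op exp_birkhoff_sum_\<psi> scaleR_conv_of_real mult.assoc)

section \<open>The Lasota-Yorke inequality\<close>

lemma norm_T_le:
  assumes "\<And>y. y \<in> subshift A \<Longrightarrow> norm (h y) \<le> S" "x \<in> subshift A"
  shows "norm (T h x) \<le> S"
proof -
  have "norm ((T ^^ 1) h x) \<le> (\<Sum>y\<in>preimages A 1 x. weight 1 y * S)"
    unfolding funpow_T[OF assms(2)]
    by (rule sum_norm_le)
      (auto simp: norm_mult abs_of_pos weight_pos preimages_subset intro!: assms(1))
  also have "\<dots> = S"
    using sum_weight[OF assms(2), of 1] by (simp add: sum_distrib_right[symmetric])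
  finally show ?thesis by simp
qed

text \<open>Each of at most \<open>CARD('k)\<close> inverse branches contributes \<open>Q\<close>
  from \<open>\<phi>\<close> and \<open>Q\<close> from \<open>\<omega>\<close>; the summand 2 covers
  points with different first letters.\<close>

definition K :: real where
  "K = 2 * CARD('k) * Q + 2"

lemma K_nonneg: "0 \<le> K"
  using Q_nonneg by (simp add: K_def)

text \<open>Inverse branches contract by \<open>l\<close> and the weights sum to 1, so
  \<open>D\<close> returns as \<open>l * D\<close>; the variation of \<open>exp (\<psi> y)\<close>
  costs \<open>K * S\<close>.\<close>

lemma lip_bounded_T:
  assumes "lip_bounded A l h S D" "0 \<le> S" "0 \<le> D"
  shows "lip_bounded A l (T h) S (l * D + K * S)"
  unfolding lip_bounded_def
proof safe
  have h: "norm (h y) \<le> S" if "y \<in> subshift A" for y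
    using assms that by (simp add: lip_bounded_def)
  show T: "norm (T h x) \<le> S" if "x \<in> subshift A" for x
    by (rule norm_T_le) (use h that in auto)
  fix x x' assume X: "x \<in> subshift A" "x' \<in> subshift A"
  let ?d = "shift_dist l x x'"
  have d: "0 \<le> ?d" using l_pos by (rule shift_dist_nonneg)
  show "norm (T h x - T h x') \<le> (l * D + K * S) * ?d"
  proof (cases "x 0 = x' 0")
    case False
    have "norm (T h x - T h x') \<le> S + S"
      using norm_triangle_ineq4[of "T h x" "T h x'"] T[OF X(1)] T[OF X(2)] by linarith
    also have "\<dots> \<le> l * D + K * S"
      using assms l_pos Q_nonneg by (simp add: K_def algebra_simps)
    finally show ?thesis using shift_dist_eq_1[of x x' l] False by simp
  next
    case True
    define E where "E = {a. case_nat a x \<in> subshift A}"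
    have E_iff: "case_nat a z \<in> subshift A \<longleftrightarrow> A $ a $ z 0 = 1 \<and> z \<in> subshift A" for a z
      by (auto simp: subshift_def split: nat.split)
    \<comment> \<open>Which letters may be prepended depends only on the first letter, so both sums
      run over the same set.\<close>
    have E': "E = {a. case_nat a x' \<in> subshift A}"
      unfolding E_def E_iff using X True by auto
    have inj: "inj_on (\<lambda>a. case_nat a z) F" for z :: "nat \<Rightarrow> 'k" and F
      by (auto simp: inj_on_def fun_eq_iff dest!: spec[of _ 0])
    have T_x: "T h x = (\<Sum>a\<in>E. exp (\<psi> (case_nat a x)) * h (case_nat a x))"
      unfolding transfer_op_preimages preimages_1_eq sum.reindex[OF inj] by (simp add: E_def)
    have T_x': "T h x' = (\<Sum>a\<in>E. exp (\<psi> (case_nat a x')) * h (case_nat a x'))"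
      unfolding transfer_op_preimages preimages_1_eq sum.reindex[OF inj] by (simp add: E')
    have W: "(\<Sum>a\<in>E. exp (\<phi> (case_nat a x'))) = 1"
      using sum_weight[OF X(2), of 1] unfolding preimages_1_eq sum.reindex[OF inj] E'
      by (simp add: weight_def birkhoff_sum_def)
    \<comment> \<open>The change of the exponentials is separated from the change of
      \<open>h\<close>; the latter carries the weights at \<open>x'\<close>, which sum to 1 by
      \<open>W\<close>.\<close>
    have "norm (T h x - T h x') = norm (\<Sum>a\<in>E.
        (exp (\<psi> (case_nat a x)) - exp (\<psi> (case_nat a x'))) * h (case_nat a x) +
        exp (\<psi> (case_nat a x')) * (h (case_nat a x) - h (case_nat a x')))"
      unfolding T_x T_x' by (simp add: sum_subtractf[symmetric] algebra_simps)
    also have "\<dots> \<le> (\<Sum>a\<in>E. 2 * Q * ?d * S + exp (\<phi> (case_nat a x')) * (D * l * ?d))"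
    proof (rule sum_norm_le)
      fix a assume "a \<in> E"
      then have Y: "case_nat a x \<in> subshift A" "case_nat a x' \<in> subshift A"
        using E' by (auto simp: E_def)
      let ?y = "case_nat a x" and ?y' = "case_nat a x'"
      have dy: "shift_dist l ?y ?y' = l * ?d" using shift_dist_case_nat[OF l_pos] .
      have ld: "Q * (l * ?d) \<le> Q * ?d"
        using d l_pos l_less_1 Q_nonneg by (intro mult_left_mono mult_left_le_one_le) auto
      have "norm (exp (\<psi> ?y) - exp (\<psi> ?y')) \<le> norm (\<psi> ?y - \<psi> ?y')"
        by (rule norm_exp_diff_le) (use Y \<phi>_nonpos in \<open>auto simp: \<psi>_def\<close>)
      also have "\<dots> \<le> \<bar>\<phi> ?y - \<phi> ?y'\<bar> + \<bar>\<omega> ?y - \<omega> ?y'\<bar>"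
        using cmod_le[of "\<psi> ?y - \<psi> ?y'"] by (simp add: \<psi>_def)
      also have "\<dots> \<le> 2 * Q * ?d"
        using \<phi>_Lipschitz[OF Y] \<omega>_Lipschitz[OF Y] ld unfolding dy by linarith
      finally have 1: "norm (exp (\<psi> ?y) - exp (\<psi> ?y')) * norm (h ?y) \<le> 2 * Q * ?d * S"
        by (rule mult_mono) (use h Y d Q_nonneg in auto)
      have "norm (h ?y - h ?y') \<le> D * (l * ?d)"
        using assms(1) Y unfolding lip_bounded_def dy[symmetric] by blast
      then have 2: "norm (exp (\<psi> ?y')) * norm (h ?y - h ?y') \<le> exp (\<phi> ?y') * (D * l * ?d)"
        by (simp add: \<psi>_def mult.assoc)
      show "norm ((exp (\<psi> ?y) - exp (\<psi> ?y')) * h ?y + exp (\<psi> ?y') * (h ?y - h ?y'))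
          \<le> 2 * Q * ?d * S + exp (\<phi> ?y') * (D * l * ?d)"
        using norm_triangle_ineq[of "(exp (\<psi> ?y) - exp (\<psi> ?y')) * h ?y"
            "exp (\<psi> ?y') * (h ?y - h ?y')"] 1 2
        by (simp add: norm_mult)
    qed
    also have "\<dots> = card E * (2 * Q * ?d * S) + D * l * ?d"
      using W by (simp add: sum.distrib sum_distrib_right[symmetric])
    also have "\<dots> \<le> CARD('k) * (2 * Q * ?d * S) + D * l * ?d"
      by (intro add_mono mult_right_mono)
        (use assms d Q_nonneg l_pos in \<open>auto intro!: card_mono\<close>)
    also have "\<dots> \<le> (l * D + K * S) * ?d"
      using assms d by (simp add: K_def algebra_simps)
    finally show ?thesis .
  qed
qed

text \<open>\<open>K * S / (1 - l)\<close> is the sum of the geometric series of errors in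
  \<open>lip_bounded_T\<close>.\<close>

lemma lip_bounded_funpow_T:
  assumes "lip_bounded A l h S D" "0 \<le> S" "0 \<le> D"
  shows "lip_bounded A l ((T ^^ n) h) S (l ^ n * D + K * S / (1 - l))"
proof (induction n)
  case 0
  show ?case
    using lip_bounded_mono[OF assms(1) l_pos, of S "l ^ 0 * D + K * S / (1 - l)"] assms K_nonneg l_less_1
    by simp
next
  case (Suc n)
  have "lip_bounded A l (T ((T ^^ n) h)) S (l * (l ^ n * D + K * S / (1 - l)) + K * S)"
    by (rule lip_bounded_T[OF Suc])
      (use assms K_nonneg l_less_1 l_pos in auto)
  also have "l * (l ^ n * D + K * S / (1 - l)) + K * S = l ^ Suc n * D + K * S / (1 - l)"
    using l_less_1 by (simp add: field_simps)
  finally show ?case by simp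
qed

text \<open>For such \<open>D\<close> one has \<open>l * D + K \<le> D\<close>, so a single bound
  serves all iterates at once.\<close>

lemma lip_bounded_funpow_T_invariant:
  assumes "lip_bounded A l h 1 D" "0 \<le> D" "K \<le> (1 - l) * D"
  shows "lip_bounded A l ((T ^^ n) h) 1 D"
proof (induction n)
  case 0
  show ?case using assms by simp
next
  case (Suc n)
  have "lip_bounded A l (T ((T ^^ n) h)) 1 (l * D + K * 1)"
    by (rule lip_bounded_T[OF Suc]) (use assms in auto)
  from lip_bounded_mono[OF this l_pos, of 1 D] show ?case
    using assms(3) by (simp add: algebra_simps)
qed

text \<open>\<open>convex_combination_near_sphere\<close> applied to \<open>funpow_T\<close>;
  dividing by the lower bound \<open>weight_ge\<close> costs the factor
  \<open>exp (\<Phi> * k)\<close>.\<close>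

lemma aligned_terms:
  assumes g: "\<And>y. y \<in> subshift A \<Longrightarrow> norm (g y) \<le> 1"
    and x: "x \<in> subshift A" and "1 - \<epsilon> \<le> norm ((T ^^ k) g x)" "0 \<le> \<epsilon>" and y: "y \<in> preimages A k x"
  shows "norm (cis (birkhoff_sum \<omega> k y) * g y - (T ^^ k) g x) \<le> sqrt (2 * \<epsilon> * exp (\<Phi> * k))"
proof -
  let ?r = "norm (cis (birkhoff_sum \<omega> k y) * g y - (T ^^ k) g x)"
  have "exp (- (\<Phi> * k)) * ?r\<^sup>2 \<le> weight k y * ?r\<^sup>2"
    using weight_ge[OF preimages_subset[OF y]] by (intro mult_right_mono) auto
  also have "\<dots> \<le> 2 * \<epsilon>"
    by (rule convex_combination_near_sphere[where S = "preimages A k x"])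
      (use assms in \<open>auto simp: finite_preimages sum_weight less_imp_le[OF weight_pos]
        norm_mult preimages_subset funpow_T\<close>)
  finally have "?r\<^sup>2 \<le> 2 * \<epsilon> * exp (\<Phi> * k)"
    by (simp add: exp_minus field_simps)
  then show ?thesis by (rule real_le_rsqrt)
qed

section \<open>Phases at periodic points for a function with a nearly unimodular iterate\<close>

context
  fixes h D p
  assumes h: "\<And>k. lip_bounded A l ((T ^^ k) h) 1 D"
    and D_nonneg: "0 \<le> D" and gap: "connecting_gap A p"
begin

lemma norm_funpow_le: "x \<in> subshift A \<Longrightarrow> norm ((T ^^ k) h x) \<le> 1"
  using h[of k] by (simp add: lip_bounded_def)

lemma funpow_Lipschitz:
  "x \<in> subshift A \<Longrightarrow> y \<in> subshift A \<Longrightarrow>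
    norm ((T ^^ k) h x - (T ^^ k) h y) \<le> D * shift_dist l x y"
  using h[of k] by (simp add: lip_bounded_def)

text \<open>Some preimage \<open>y\<close> of \<open>x\<close> under \<open>n - k\<close> steps lies
  near \<open>z\<close>. Alignment carries the modulus from \<open>x\<close> to \<open>y\<close>,
  the Lipschitz bound from \<open>y\<close> to \<open>z\<close>. As \<open>t\<close> bounds the
  number of remaining steps from below, the error is uniform in \<open>k\<close>.\<close>

lemma near_unimodular_everywhere:
  assumes "x \<in> subshift A" "1 - \<epsilon> \<le> norm ((T ^^ n) h x)" "0 \<le> \<epsilon>"
    and "p \<le> t" "k + t \<le> n" "z \<in> subshift A"
  shows "1 - (\<epsilon> + sqrt (2 * \<epsilon> * exp (\<Phi> * n)) + D * l ^ (t - p)) \<le> norm ((T ^^ k) h z)"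
proof -
  have t: "p \<le> n - k" using assms by simp
  obtain y where y: "y \<in> preimages A (n - k) x" "shift_dist l y z \<le> l ^ (n - k - p)"
    using preimages_dense[OF l_pos l_less_1 gap assms(1,6) t] by blast
  have "(T ^^ (n - k)) ((T ^^ k) h) x = (T ^^ n) h x"
    using assms(5) funpow_add[of "n - k" k T] by simp
  then have "norm (cis (birkhoff_sum \<omega> (n - k) y) * (T ^^ k) h y - (T ^^ n) h x)
      \<le> sqrt (2 * \<epsilon> * exp (\<Phi> * (n - k)))"
    using aligned_terms[where g = "(T ^^ k) h", OF norm_funpow_le assms(1) _ assms(3) y(1)] assms(2) by simp
  also have "\<dots> \<le> sqrt (2 * \<epsilon> * exp (\<Phi> * n))"
    using assms \<Phi>_nonneg by (intro real_sqrt_le_mono mult_left_mono) (auto intro!: mult_left_mono)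
  finally have 1: "norm ((T ^^ n) h x) - norm ((T ^^ k) h y) \<le> sqrt (2 * \<epsilon> * exp (\<Phi> * n))"
    using norm_triangle_ineq2[of "(T ^^ n) h x" "cis (birkhoff_sum \<omega> (n - k) y) * (T ^^ k) h y"]
    by (simp add: norm_mult norm_minus_commute)
  have "norm ((T ^^ k) h y - (T ^^ k) h z) \<le> D * shift_dist l y z"
    using funpow_Lipschitz assms(6) preimages_subset[OF y(1)] by blast
  also have "\<dots> \<le> D * l ^ (t - p)"
    by (intro mult_left_mono D_nonneg order_trans[OF y(2)] power_decreasing)
      (use assms l_pos l_less_1 in auto)
  finally have 2: "norm ((T ^^ k) h y) - norm ((T ^^ k) h z) \<le> D * l ^ (t - p)"
    using norm_triangle_ineq2[of "(T ^^ k) h y" "(T ^^ k) h z"] by linarith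
  show ?thesis using 1 2 assms(2) by linarith
qed

text \<open>
  Deep preimages of \<open>x\<close> come close to every periodic point \<open>z\<close>, so the ratio of \<open>T\<^sup>s h\<close> to
  \<open>T\<^bsup>s-q\<^esup> h\<close> at \<open>z\<close> is close to a number independent of \<open>z\<close>; by periodicity it is also close
  to \<open>cis (birkhoff_sum \<omega> q z)\<close>.
\<close>
lemma periodic_phase_ratio:
  assumes x: "x \<in> subshift A" and z: "z \<in> subshift A" "(left_shift ^^ q) z = z"
    and unimod: "\<And>k z. k \<le> m \<Longrightarrow> z \<in> subshift A \<Longrightarrow> 1 - \<epsilon> \<le> norm ((T ^^ k) h z)"
    and "0 \<le> \<epsilon>" "p \<le> t" "q \<le> t" "t + q \<le> m"
  shows "norm ((T ^^ m) h x - cis (birkhoff_sum \<omega> q z) * (T ^^ (m - q)) h x)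
    \<le> 3 * sqrt (2 * \<epsilon> * exp (\<Phi> * t)) + 2 * (D * l ^ (t - p))"
proof -
  let ?\<eta> = "sqrt (2 * \<epsilon> * exp (\<Phi> * t))" and ?\<delta> = "D * l ^ (t - p)"
  let ?s = "m - t"
  let ?s' = "m - t - q"
  obtain y where y: "y \<in> preimages A t x" "shift_dist l y z \<le> l ^ (t - p)"
    using preimages_dense[OF l_pos l_less_1 gap x z(1) \<open>p \<le> t\<close>] by blast
  \<comment> \<open>The iterates of order \<open>m\<close> and \<open>m - q\<close> at
    \<open>x\<close> both lie \<open>t\<close> steps beyond those used at \<open>y\<close>, so the
    same phase \<open>F\<close> occurs in both comparisons.\<close>
  define F where "F = cis (birkhoff_sum \<omega> t y)"
  define E where "E = cis (birkhoff_sum \<omega> q z)"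
  have FE: "norm F = 1" "norm E = 1" by (simp_all add: F_def E_def)
  have comp: "(T ^^ i) ((T ^^ j) h) = (T ^^ (i + j)) h" for i j
    by (simp add: funpow_add)
  have 1: "norm (F * (T ^^ ?s) h y - (T ^^ m) h x) \<le> ?\<eta>"
    using aligned_terms[where g = "(T ^^ ?s) h", OF norm_funpow_le x _ \<open>0 \<le> \<epsilon>\<close> y(1)] unimod[of m x] x assms
    by (simp add: comp F_def)
  have 2: "norm (F * (T ^^ ?s') h y - (T ^^ (m - q)) h x) \<le> ?\<eta>"
    using aligned_terms[where g = "(T ^^ ?s') h", OF norm_funpow_le x _ \<open>0 \<le> \<epsilon>\<close> y(1)] unimod[of "m - q" x] x assms
    by (simp add: comp F_def)
  \<comment> \<open>Being its own preimage, \<open>z\<close> aligns with itself over one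
    period.\<close>
  have "z \<in> preimages A q z" using z by (simp add: preimages_def)
  then have "norm (E * (T ^^ ?s') h z - (T ^^ ?s) h z) \<le> sqrt (2 * \<epsilon> * exp (\<Phi> * q))"
    using aligned_terms[where g = "(T ^^ ?s') h" and k = q and y = z, OF norm_funpow_le z(1) _ \<open>0 \<le> \<epsilon>\<close>] unimod[of ?s z] z assms
    by (simp add: comp E_def)
  also have "\<dots> \<le> ?\<eta>"
    using assms \<Phi>_nonneg by (intro real_sqrt_le_mono mult_left_mono) (auto intro!: mult_left_mono)
  finally have 3: "norm (E * (T ^^ ?s') h z - (T ^^ ?s) h z) \<le> ?\<eta>" .
  have close: "norm ((T ^^ k) h y - (T ^^ k) h z) \<le> ?\<delta>" for k
    using funpow_Lipschitz[OF preimages_subset[OF y(1)] z(1), of k] mult_left_mono[OF y(2) D_nonneg]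
    by linarith
  show ?thesis
    using norm_diff_rotation_le[OF FE 1 2 3 close close] by (simp add: E_def)
qed

text \<open>The phases at \<open>z\<close> and \<open>w\<close> are compared through common values
  at \<open>x\<close>. The \<open>t\<^sub>1\<close> steps make the earlier iterates nearly
  unimodular, the \<open>t\<^sub>2\<close> steps reach the periodic points.\<close>

lemma periodic_phases_aligned:
  assumes "x \<in> subshift A" "1 - \<epsilon> \<le> norm ((T ^^ n) h x)" "0 \<le> \<epsilon>"
    and "p \<le> t\<^sub>1" "p \<le> t\<^sub>2" "q \<le> t\<^sub>2" "t\<^sub>1 + t\<^sub>2 + q \<le> n"
    and \<epsilon>': "\<epsilon>' = \<epsilon> + sqrt (2 * \<epsilon> * exp (\<Phi> * n)) + D * l ^ (t\<^sub>1 - p)" "\<epsilon>' \<le> 1 / 2"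
    and z: "z \<in> subshift A" "(left_shift ^^ q) z = z" and w: "w \<in> subshift A" "(left_shift ^^ q) w = w"
  shows "norm (cis (birkhoff_sum \<omega> q z) - cis (birkhoff_sum \<omega> q w))
    \<le> 4 * (3 * sqrt (2 * \<epsilon>' * exp (\<Phi> * t\<^sub>2)) + 2 * (D * l ^ (t\<^sub>2 - p)))"
proof -
  let ?\<kappa> = "3 * sqrt (2 * \<epsilon>' * exp (\<Phi> * t\<^sub>2)) + 2 * (D * l ^ (t\<^sub>2 - p))"
  let ?m = "n - t\<^sub>1"
  let ?a = "(T ^^ ?m) h x" and ?a' = "(T ^^ (?m - q)) h x"
  have unimod: "1 - \<epsilon>' \<le> norm ((T ^^ k) h v)" if "k \<le> ?m" "v \<in> subshift A" for k v
    unfolding \<epsilon>'(1) by (rule near_unimodular_everywhere[OF assms(1-4)]) (use that assms in auto)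
  have "0 \<le> \<epsilon>'" using \<epsilon>' assms(3) D_nonneg l_pos by simp
  then have ratio: "norm (?a - cis (birkhoff_sum \<omega> q v) * ?a') \<le> ?\<kappa>"
    if "v \<in> subshift A" "(left_shift ^^ q) v = v" for v
    by (intro periodic_phase_ratio[OF assms(1) that unimod]) (use assms in auto)
  \<comment> \<open>Dividing by this value costs a factor 2; the two ratio errors supply the other 2
    in the constant 4.\<close>
  have "1 / 2 \<le> norm ?a'" using unimod[of "?m - q" x] assms(1) \<epsilon>'(2) by linarith
  then have "norm (cis (birkhoff_sum \<omega> q z) - cis (birkhoff_sum \<omega> q w)) * (1 / 2)
      \<le> norm (cis (birkhoff_sum \<omega> q z) - cis (birkhoff_sum \<omega> q w)) * norm ?a'"
    by (rule mult_left_mono) simp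
  also have "\<dots> = norm ((?a - cis (birkhoff_sum \<omega> q w) * ?a') - (?a - cis (birkhoff_sum \<omega> q z) * ?a'))"
    by (simp add: norm_mult[symmetric] algebra_simps)
  also have "\<dots> \<le> ?\<kappa> + ?\<kappa>"
    by (intro norm_triangle_le_diff add_mono ratio z w)
  finally show ?thesis by simp
qed

end

end

subsection \<open>The weighted norm\<close>

lemma shift_Lipschitz_bound:
  assumes "0 < l" "l < 1" "shift_Lipschitz A l f"
  obtains L where "L > 0"
    "\<And>x y. x \<in> subshift A \<Longrightarrow> y \<in> subshift A \<Longrightarrow> norm (f x - f y) \<le> L * shift_dist l x y"
  using assms
  by (auto simp: shift_Lipschitz_def Lipschitz_continuous_map_pos mspace_shift_metric
      mdist_shift_metric dist_norm)

text \<open>A real supremum dominates its set only if the set is bounded above; membership in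
  \<open>Lip_space\<close> and diameter at most 1 ensure this.\<close>

lemma lip_bounded_weighted_norm:
  assumes l: "0 < l" "l < 1" and h: "h \<in> Lip_space A l" and "0 < C" "0 < B"
  shows "lip_bounded A l h (weighted_norm A l C B h) (C * B * weighted_norm A l C B h)"
proof -
  obtain L where L: "L > 0"
    "\<And>x y. x \<in> subshift A \<Longrightarrow> y \<in> subshift A \<Longrightarrow> norm (h x - h y) \<le> L * shift_dist l x y"
    using shift_Lipschitz_bound[OF l] h unfolding Lip_space_def by blast
  have le: "norm (h x) \<le> norm (h z) + L" if "x \<in> subshift A" "z \<in> subshift A" for x z
  proof -
    have "norm (h x - h z) \<le> L * 1"
      by (rule order_trans[OF L(2)[OF that]]) (use L shift_dist_le_1[OF l] in auto)
    then show ?thesis using norm_triangle_ineq2[of "h x" "h z"] by linarith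
  qed
  have bdd: "bdd_above ((\<lambda>x. norm (h x)) ` subshift A)"
  proof (cases "subshift A = {}")
    case False
    then obtain z where "z \<in> subshift A" by blast
    then show ?thesis
      using le by (intro bdd_aboveI2[where M = "norm (h z) + L"]) auto
  qed simp
  have quot: "norm (h x - h y) / shift_dist l x y \<le> L"
    if "x \<in> subshift A" "y \<in> subshift A" for x y
    using L that shift_dist_pos[OF l(1), of x y] by (cases "x = y") (auto simp: divide_le_eq)
  then have bdd': "bdd_above ((\<lambda>(x, y). norm (h x - h y) / shift_dist l x y) ` (subshift A \<times> subshift A))"
    by (intro bdd_aboveI2[where M = L]) auto
  have sup: "norm (h x) \<le> sup_norm A h" if "x \<in> subshift A" for x
    unfolding sup_norm_def by (rule cSUP_upper[OF that bdd])
  have lip: "norm (h x - h y) \<le> Lip_seminorm A l h * shift_dist l x y"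
    if "x \<in> subshift A" "y \<in> subshift A" for x y
  proof (cases "x = y")
    case False
    have "norm (h x - h y) / shift_dist l x y \<le> Lip_seminorm A l h"
      unfolding Lip_seminorm_def using cSUP_upper[OF _ bdd', of "(x, y)"] that by auto
    then show ?thesis using shift_dist_pos[OF l(1) False] by (simp add: divide_le_eq)
  qed (simp add: shift_dist_def)
  have "Lip_seminorm A l h \<le> C * B * weighted_norm A l C B h"
    using assms(4,5) by (simp add: weighted_norm_def max_mult_distrib_left)
  moreover have "sup_norm A h \<le> weighted_norm A l C B h"
    by (simp add: weighted_norm_def)
  moreover have "lip_bounded A l h (sup_norm A h) (Lip_seminorm A l h)"
    using sup lip by (simp add: lip_bounded_def)
  ultimately show ?thesis using lip_bounded_mono l(1) by blast
qed

lemma weighted_norm_le: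
  assumes l: "0 < l" and h: "lip_bounded A l h S D" and "subshift A \<noteq> {}" "0 < C" "0 < B"
    and "S \<le> W" "0 \<le> D" "D \<le> C * B * W"
  shows "weighted_norm A l C B h \<le> W"
proof -
  have "sup_norm A h \<le> S"
    unfolding sup_norm_def by (rule cSUP_least) (use assms in \<open>auto simp: lip_bounded_def\<close>)
  moreover have "Lip_seminorm A l h \<le> D"
    unfolding Lip_seminorm_def
  proof (rule cSUP_least)
    fix xy assume "xy \<in> subshift A \<times> subshift A"
    then obtain x y where xy: "xy = (x, y)" "x \<in> subshift A" "y \<in> subshift A" by blast
    then have "norm (h x - h y) \<le> D * shift_dist l x y"
      using h by (simp add: lip_bounded_def)
    \<comment> \<open>Diagonal pairs have quotient 0, which is where \<open>0 \<le> D\<close>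
      enters.\<close>
    then have "norm (h x - h y) / shift_dist l x y \<le> D"
      using \<open>0 \<le> D\<close> shift_dist_pos[OF l, of x y] by (cases "x = y") (auto simp: divide_le_eq)
    then show "(case xy of (x, y) \<Rightarrow> norm (h x - h y) / shift_dist l x y) \<le> D"
      by (simp add: xy)
  qed (use assms in auto)
  then have "Lip_seminorm A l h / (C * B) \<le> W"
    using assms by (simp add: divide_le_eq mult.commute)
  ultimately show ?thesis using assms by (simp add: weighted_norm_def)
qed

subsection \<open>Phases and Diophantine approximation\<close>

text \<open>\<open>sin u\<close> differs from \<open>u\<close> by at most
  \<open>\<bar>u\<bar> ^ 3 / 6\<close>, and \<open>\<bar>u\<bar> \<le> 2\<close> leaves a third of
  \<open>\<bar>u\<bar>\<close>.\<close>

lemma abs_sin_ge_third: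
  fixes u :: real
  assumes "\<bar>u\<bar> \<le> pi / 2"
  shows "\<bar>u\<bar> / 3 \<le> \<bar>sin u\<bar>"
proof -
  have "\<bar>u\<bar> \<le> 2" using assms pi_less_4 by linarith
  then have "\<bar>u\<bar> * (\<bar>u\<bar> * \<bar>u\<bar>) \<le> \<bar>u\<bar> * (2 * 2)"
    by (intro mult_left_mono mult_mono) auto
  moreover have "\<bar>sin u - u\<bar> \<le> \<bar>u\<bar> * (\<bar>u\<bar> * \<bar>u\<bar>) / 6"
    using Maclaurin_sin_bound[of u 3]
    by (simp add: eval_nat_numeral sin_coeff_def fact_numeral divide_simps)
  ultimately show ?thesis by linarith
qed

text \<open>With \<open>p\<close> the nearest integer, half the reduced angle has modulus at most
  \<open>pi / 2\<close>, where the chord length \<open>2 * \<bar>sin u\<bar>\<close> controls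
  it.\<close>

lemma cis_diff_near_multiple:
  "\<exists>p::int. \<bar>s - t - 2 * pi * p\<bar> \<le> 3 * norm (cis s - cis t)"
proof -
  define p where "p = round ((s - t) / (2 * pi))"
  define u where "u = (s - t - 2 * pi * p) / 2"
  have "\<bar>of_int p - (s - t) / (2 * pi)\<bar> \<le> 1 / 2"
    unfolding p_def by (rule of_int_round_abs_le)
  moreover have "u = pi * ((s - t) / (2 * pi) - of_int p)"
    by (simp add: u_def field_simps)
  ultimately have "\<bar>u\<bar> \<le> pi / 2"
    by (simp add: abs_mult abs_minus_commute)
  then have "\<bar>u\<bar> / 3 \<le> \<bar>sin u\<bar>" by (rule abs_sin_ge_third)
  moreover have "norm (cis s - cis t) = 2 * \<bar>sin u\<bar>"
  proof -
    have "2 * u = (s - t) - 2 * pi * p" by (simp add: u_def)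
    then have "cis (2 * u) = cis (s - t) / cis (2 * pi * p)"
      by (simp only: cis_divide)
    then have "cis s - cis t = cis t * (cis (2 * u) - 1)"
      by (simp add: cis_divide[symmetric] right_diff_distrib)
    then have "norm (cis s - cis t) = norm (exp (\<i> * of_real (2 * u)) - 1)"
      by (simp add: norm_mult cis_conv_exp)
    also have "\<dots> = 2 * \<bar>sin u\<bar>" by (simp only: dist_exp_i_1) simp
    finally show ?thesis .
  qed
  ultimately show ?thesis by (intro exI[of _ p]) (auto simp: u_def)
qed

section \<open>Integer linear forms\<close>

lemma int_l1_ge_1: "m \<noteq> 0 \<Longrightarrow> 1 \<le> int_l1 m"
proof -
  assume "m \<noteq> 0"
  then obtain i where "m $ i \<noteq> 0" by (metis vec_eq_iff zero_index)
  then have "1 \<le> \<bar>real_of_int (m $ i)\<bar>" by linarith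
  also have "\<dots> \<le> int_l1 m"
    unfolding int_l1_def by (rule member_le_sum) auto
  finally show ?thesis .
qed

lemma int_dot_diff: "int_dot m (x - y) = int_dot m x - int_dot m y"
  by (simp add: int_dot_def sum_subtractf algebra_simps)

lemma int_dot_scaleR: "int_dot m (c *\<^sub>R x) = c * int_dot m x"
  by (simp add: int_dot_def sum_distrib_left mult_ac)

lemma int_dot_le: "\<bar>int_dot m x\<bar> \<le> int_l1 m * norm x"
proof -
  have "\<bar>int_dot m x\<bar> \<le> (\<Sum>i\<in>UNIV. \<bar>of_int (m $ i)\<bar> * norm x)"
    unfolding int_dot_def
    by (rule order_trans[OF sum_abs])
      (auto intro!: sum_mono mult_left_mono component_le_norm_cart simp: abs_mult)
  then show ?thesis by (simp add: int_l1_def sum_distrib_right)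
qed

lemma int_dot_sum: "int_dot m (\<Sum>i\<in>S. f i) = (\<Sum>i\<in>S. int_dot m (f i))"
proof -
  have "(\<Sum>j\<in>UNIV. of_int (m $ j) * (\<Sum>i\<in>S. f i $ j)) =
      (\<Sum>i\<in>S. \<Sum>j\<in>UNIV. of_int (m $ j) * f i $ j)"
    unfolding sum_distrib_left by (rule sum.swap)
  then show ?thesis by (simp add: int_dot_def)
qed

text \<open>
  Eliminating \<open>b\<close> from the two approximate congruences modulo \<open>2\<pi>\<close> leaves the linear form
  in \<open>\<alpha>\<close> and \<open>\<beta>\<close>.
\<close>
lemma diophantine_phase_gap:
  fixes R\<^sub>1 R\<^sub>2 R\<^sub>3 \<alpha> b \<kappa> :: real and V\<^sub>1 V\<^sub>2 V\<^sub>3 \<beta> :: "real^'d" and m :: "int^'d"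
  assumes \<alpha>: "\<alpha> = (R\<^sub>1 - R\<^sub>2) / (R\<^sub>2 - R\<^sub>3)" and "R\<^sub>2 \<noteq> R\<^sub>3"
    and \<beta>: "\<beta> = (1 / (2 * pi)) *\<^sub>R (V\<^sub>1 - V\<^sub>2) - (1 / (2 * pi) * \<alpha>) *\<^sub>R (V\<^sub>2 - V\<^sub>3)"
    and dioph: "\<And>(p::int) (q::int). c * (\<bar>of_int q\<bar> + int_l1 m) powr (- \<gamma>)
      \<le> \<bar>of_int q * \<alpha> + int_dot m \<beta> - of_int p\<bar>"
    and "m \<noteq> 0" "0 \<le> c" "0 \<le> \<gamma>" "\<kappa> \<le> 1" "\<bar>b\<bar> \<le> B" and l1_le: "int_l1 m \<le> B"
    and s: "s\<^sub>1 = - b * R\<^sub>1 + int_dot m V\<^sub>1" "s\<^sub>2 = - b * R\<^sub>2 + int_dot m V\<^sub>2"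
      "s\<^sub>3 = - b * R\<^sub>3 + int_dot m V\<^sub>3"
    and cis: "norm (cis s\<^sub>1 - cis s\<^sub>2) \<le> 4 * \<kappa>" "norm (cis s\<^sub>2 - cis s\<^sub>3) \<le> 4 * \<kappa>"
  shows "c * ((\<bar>R\<^sub>2\<bar> + \<bar>R\<^sub>3\<bar> + norm V\<^sub>2 + norm V\<^sub>3 + 3) * B) powr (- \<gamma>) \<le> 2 * \<kappa> * (1 + \<bar>\<alpha>\<bar>)"
proof -
  obtain p :: int where "\<bar>s\<^sub>1 - s\<^sub>2 - 2 * pi * p\<bar> \<le> 3 * norm (cis s\<^sub>1 - cis s\<^sub>2)"
    using cis_diff_near_multiple by blast
  then have p: "\<bar>s\<^sub>1 - s\<^sub>2 - 2 * pi * p\<bar> \<le> 12 * \<kappa>"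
    using cis(1) by linarith
  obtain q :: int where "\<bar>s\<^sub>2 - s\<^sub>3 - 2 * pi * q\<bar> \<le> 3 * norm (cis s\<^sub>2 - cis s\<^sub>3)"
    using cis_diff_near_multiple by blast
  then have q: "\<bar>s\<^sub>2 - s\<^sub>3 - 2 * pi * q\<bar> \<le> 12 * \<kappa>"
    using cis(2) by linarith
  have l1: "1 \<le> int_l1 m" using \<open>m \<noteq> 0\<close> by (rule int_l1_ge_1)
  then have B: "1 \<le> B" using assms by linarith
  have s_le: "\<bar>- b * R + int_dot m V\<bar> \<le> B * (\<bar>R\<bar> + norm V)" for R V
  proof -
    have "\<bar>- b * R + int_dot m V\<bar> \<le> \<bar>b\<bar> * \<bar>R\<bar> + int_l1 m * norm V"
      using int_dot_le[of m V] abs_mult[of b R] by linarith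
    also have "\<dots> \<le> B * \<bar>R\<bar> + B * norm V"
      by (intro add_mono mult_right_mono) (use assms in auto)
    finally show ?thesis by (simp add: algebra_simps)
  qed
  \<comment> \<open>The Diophantine bound becomes a power of \<open>B\<close> only once
    \<open>q\<close> is at most a multiple of \<open>B\<close>; up to a bounded error
    \<open>2 * pi * q\<close> is \<open>s\<^sub>2 - s\<^sub>3\<close>, whose size is linear in
    \<open>B\<close>.\<close>
  have "2 * pi * \<bar>real_of_int q\<bar> \<le> \<bar>s\<^sub>2\<bar> + \<bar>s\<^sub>3\<bar> + 12"
    using q \<open>\<kappa> \<le> 1\<close> abs_mult[of "2 * pi" "real_of_int q"] by simp
  moreover have "6 * \<bar>real_of_int q\<bar> \<le> 2 * pi * \<bar>real_of_int q\<bar>"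
    using pi_gt3 by (intro mult_right_mono) auto
  ultimately have "6 * \<bar>real_of_int q\<bar> \<le> B * (\<bar>R\<^sub>2\<bar> + norm V\<^sub>2) + B * (\<bar>R\<^sub>3\<bar> + norm V\<^sub>3) + 12 * B"
    using s_le[of R\<^sub>2 V\<^sub>2] s_le[of R\<^sub>3 V\<^sub>3] B unfolding s by linarith
  moreover have "0 \<le> B * (\<bar>R\<^sub>2\<bar> + norm V\<^sub>2) + B * (\<bar>R\<^sub>3\<bar> + norm V\<^sub>3)"
    using B by (intro add_nonneg_nonneg mult_nonneg_nonneg) auto
  ultimately have "\<bar>real_of_int q\<bar> \<le> B * (\<bar>R\<^sub>2\<bar> + norm V\<^sub>2) + B * (\<bar>R\<^sub>3\<bar> + norm V\<^sub>3) + 2 * B"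
    by linarith
  then have "\<bar>real_of_int q\<bar> + int_l1 m \<le> (\<bar>R\<^sub>2\<bar> + \<bar>R\<^sub>3\<bar> + norm V\<^sub>2 + norm V\<^sub>3 + 3) * B"
    using l1_le by (simp add: algebra_simps)
  then have "c * ((\<bar>R\<^sub>2\<bar> + \<bar>R\<^sub>3\<bar> + norm V\<^sub>2 + norm V\<^sub>3 + 3) * B) powr (- \<gamma>)
      \<le> c * (\<bar>of_int q\<bar> + int_l1 m) powr (- \<gamma>)"
    by (intro mult_left_mono powr_mono2') (use assms l1 in auto)
  also have "\<dots> \<le> \<bar>of_int q * \<alpha> + int_dot m \<beta> - of_int p\<bar>" by (rule dioph)
  also have "of_int q * \<alpha> + int_dot m \<beta> - of_int p =
      ((s\<^sub>1 - s\<^sub>2 - 2 * pi * p) - \<alpha> * (s\<^sub>2 - s\<^sub>3 - 2 * pi * q)) / (2 * pi)"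
  proof -
    have R: "\<alpha> * (R\<^sub>2 - R\<^sub>3) = R\<^sub>1 - R\<^sub>2" using \<open>R\<^sub>2 \<noteq> R\<^sub>3\<close> by (simp add: \<alpha>)
    \<comment> \<open>\<open>\<alpha>\<close> is the multiplier that cancels the coefficient of
      \<open>b\<close>.\<close>
    have "s\<^sub>1 - s\<^sub>2 - \<alpha> * (s\<^sub>2 - s\<^sub>3) =
        (int_dot m V\<^sub>1 - int_dot m V\<^sub>2) - \<alpha> * (int_dot m V\<^sub>2 - int_dot m V\<^sub>3)
        + b * (\<alpha> * (R\<^sub>2 - R\<^sub>3) - (R\<^sub>1 - R\<^sub>2))"
      unfolding s by (simp add: algebra_simps)
    also have "\<dots> = 2 * pi * int_dot m \<beta>"
      unfolding R \<beta> int_dot_diff int_dot_scaleR by (simp add: field_simps)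
    finally have "2 * pi * int_dot m \<beta> = s\<^sub>1 - s\<^sub>2 - \<alpha> * (s\<^sub>2 - s\<^sub>3)" ..
    then show ?thesis by (simp add: field_simps)
  qed
  also have "\<bar>\<dots>\<bar> \<le> (12 * \<kappa> + \<bar>\<alpha>\<bar> * (12 * \<kappa>)) / (2 * pi)"
  proof -
    have "\<bar>\<alpha> * (s\<^sub>2 - s\<^sub>3 - 2 * pi * q)\<bar> \<le> \<bar>\<alpha>\<bar> * (12 * \<kappa>)"
      unfolding abs_mult by (intro mult_left_mono q) auto
    then have "\<bar>(s\<^sub>1 - s\<^sub>2 - 2 * pi * p) - \<alpha> * (s\<^sub>2 - s\<^sub>3 - 2 * pi * q)\<bar> \<le> 12 * \<kappa> + \<bar>\<alpha>\<bar> * (12 * \<kappa>)"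
      using p by linarith
    then show ?thesis by (simp add: abs_divide divide_right_mono)
  qed
  also have "\<dots> \<le> (12 * \<kappa> + \<bar>\<alpha>\<bar> * (12 * \<kappa>)) / 6"
    using p pi_gt3 by (intro divide_left_mono) auto
  also have "\<dots> = 2 * \<kappa> * (1 + \<bar>\<alpha>\<bar>)" by (simp add: field_simps)
  finally show ?thesis .
qed

subsection \<open>Choice of scales and conclusion\<close>

text \<open>Turns decay over logarithmically many steps into a power of \<open>B\<close>, since
  \<open>ln l\<close> is negative.\<close>

lemma power_le_powr:
  fixes l :: real
  assumes "0 < l" "l < 1" "0 < B" "a * ln B \<le> t"
  shows "l ^ t \<le> B powr (ln l * a)"
proof -
  have "ln l * t \<le> ln l * (a * ln B)"
    using assms by (intro mult_left_mono_neg) auto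
  then have "exp (ln l * t) \<le> exp (ln l * (a * ln B))" by simp
  moreover have "l ^ t = exp (ln l * t)"
    using assms exp_of_nat2_mult[of "ln l" t] by simp
  ultimately show ?thesis using assms by (simp add: powr_def mult.assoc)
qed

text \<open>Collects the numerical conditions of \<open>periodic_phases_aligned\<close> for the
  Lipschitz bound \<open>D * B\<close>, together with the two conditions on \<open>\<kappa>\<close>
  that make \<open>diophantine_phase_gap\<close> contradictory.\<close>

definition admissible_scales ::
    "real \<Rightarrow> real \<Rightarrow> real \<Rightarrow> real \<Rightarrow> real \<Rightarrow> nat \<Rightarrow> nat \<Rightarrow> real \<Rightarrow> nat \<Rightarrow> real \<Rightarrow> bool" where
  "admissible_scales l \<Phi> D \<gamma> M p q B n \<epsilon> \<longleftrightarrow>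
    (\<exists>t\<^sub>1 t\<^sub>2 \<epsilon>' \<kappa>. p \<le> t\<^sub>1 \<and> p \<le> t\<^sub>2 \<and> q \<le> t\<^sub>2 \<and> t\<^sub>1 + t\<^sub>2 + q \<le> n \<and>
      \<epsilon>' = \<epsilon> + sqrt (2 * \<epsilon> * exp (\<Phi> * n)) + D * B * l ^ (t\<^sub>1 - p) \<and> \<epsilon>' \<le> 1 / 2 \<and>
      \<kappa> = 3 * sqrt (2 * \<epsilon>' * exp (\<Phi> * t\<^sub>2)) + 2 * (D * B * l ^ (t\<^sub>2 - p)) \<and> \<kappa> \<le> 1 \<and>
      M * \<kappa> < B powr (- \<gamma>))"

text \<open>
  The scales \<open>t\<^sub>2 \<lless> t\<^sub>1 \<lless> n\<close> are all proportional to \<open>ln B\<close>: \<open>l\<^bsup>t\<^sub>1\<^esup>\<close> beats \<open>exp (\<Phi> t\<^sub>2)\<close>, and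
  \<open>B\<^bsup>-C\<^sub>3\<^esup>\<close> beats \<open>exp (\<Phi> n)\<close>.
\<close>
lemma logarithmic_scales:
  fixes l \<Phi> D \<gamma> M :: real and p q n\<^sub>0 :: nat
  assumes l: "0 < l" "l < 1" and "0 \<le> \<Phi>" "0 \<le> D" "0 \<le> \<gamma>" "0 \<le> M"
  shows "\<exists>C\<^sub>2>0. \<exists>C\<^sub>3>0. \<exists>B\<^sub>0\<ge>1. \<forall>B\<ge>B\<^sub>0. n\<^sub>0 \<le> nat \<lfloor>C\<^sub>2 * ln B\<rfloor> \<and> B powr (- C\<^sub>3) \<le> 1 / 4 \<and>
    admissible_scales l \<Phi> D \<gamma> M p q B (nat \<lfloor>C\<^sub>2 * ln B\<rfloor>) (B powr (- C\<^sub>3))"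
proof -
  define \<Lambda> where "\<Lambda> = - ln l"
  have \<Lambda>: "0 < \<Lambda>" using l by (simp add: \<Lambda>_def)
  \<comment> \<open>The exponents are solved for backwards. \<open>\<tau>\<^sub>2\<close> brings
    \<open>B * l ^ t\<^sub>2\<close> to order \<open>B powr (- \<gamma> - 1)\<close>;
    \<open>G\<close> makes \<open>B powr (- G) * exp (\<Phi> * t\<^sub>2)\<close> of the order of
    its square; \<open>\<tau>\<^sub>1\<close> brings \<open>B * l ^ t\<^sub>1\<close> to order
    \<open>B powr (- G)\<close>; \<open>C\<^sub>3\<close> makes
    \<open>\<epsilon> * exp (\<Phi> * n)\<close> of order \<open>B powr (- 2 * G)\<close>. The 1 in
    \<open>C\<^sub>2\<close> leaves \<open>ln B\<close> steps for \<open>q\<close> and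
    rounding.\<close>
  define \<tau>\<^sub>2 where "\<tau>\<^sub>2 = (\<gamma> + 2) / \<Lambda>"
  define G where "G = 2 * \<gamma> + 2 + \<Phi> * \<tau>\<^sub>2"
  define \<tau>\<^sub>1 where "\<tau>\<^sub>1 = (G + 1) / \<Lambda>"
  define C\<^sub>2 where "C\<^sub>2 = \<tau>\<^sub>1 + \<tau>\<^sub>2 + 1"
  define C\<^sub>3 where "C\<^sub>3 = 2 * G + \<Phi> * C\<^sub>2"
  define E where "E = D * inverse (l ^ p)"
  \<comment> \<open>The 3 counts \<open>\<epsilon>\<close> once and the square root, crudely, twice.
    Then \<open>\<epsilon>' \<le> a * B powr (- G)\<close> and
    \<open>\<kappa> \<le> a' * B powr (- \<gamma> - 1)\<close>.\<close>
  define a where "a = 3 + E"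
  define a' where "a' = 3 * sqrt (2 * a * exp \<Phi>) + 2 * E"
  \<comment> \<open>The entry 4 yields \<open>\<epsilon> \<le> 1 / 4\<close>;
    \<open>exp (real q + 3)\<close> absorbs \<open>q\<close>, two ceilings and a floor; the next two
    make the scales exceed \<open>p\<close>, \<open>q\<close> and \<open>n\<^sub>0\<close>; the last
    three give \<open>M * \<kappa> < B powr (- \<gamma>)\<close>, \<open>\<kappa> \<le> 1\<close>
    and \<open>\<epsilon>' \<le> 1 / 2\<close>.\<close>
  define B\<^sub>0 where "B\<^sub>0 = Max {4, exp (real q + 3), exp ((real p + real n\<^sub>0) / \<tau>\<^sub>1),
      exp ((real p + real q) / \<tau>\<^sub>2), M * a' + 1, a', 2 * a}"
  have \<tau>: "0 < \<tau>\<^sub>2" "0 < \<tau>\<^sub>1" and G: "2 \<le> G" and C: "0 < C\<^sub>2" "0 < C\<^sub>3"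
  proof -
    show 1: "0 < \<tau>\<^sub>2" using \<Lambda> assms by (simp add: \<tau>\<^sub>2_def)
    show 2: "2 \<le> G" using 1 assms by (simp add: G_def)
    show 3: "0 < \<tau>\<^sub>1" using 2 \<Lambda> by (simp add: \<tau>\<^sub>1_def)
    show 4: "0 < C\<^sub>2" using 1 3 by (simp add: C\<^sub>2_def)
    show "0 < C\<^sub>3" using 2 4 assms by (simp add: C\<^sub>3_def add_pos_nonneg)
  qed
  have E: "0 \<le> E" using assms by (simp add: E_def)
  have a: "0 < a" using E by (simp add: a_def)
  have "n\<^sub>0 \<le> nat \<lfloor>C\<^sub>2 * ln B\<rfloor> \<and> B powr (- C\<^sub>3) \<le> 1 / 4 \<and>
      admissible_scales l \<Phi> D \<gamma> M p q B (nat \<lfloor>C\<^sub>2 * ln B\<rfloor>) (B powr (- C\<^sub>3))"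
    if B\<^sub>0: "B\<^sub>0 \<le> B" for B
  proof -
    define n where n: "n = nat \<lfloor>C\<^sub>2 * ln B\<rfloor>"
    define \<epsilon> where \<epsilon>: "\<epsilon> = B powr (- C\<^sub>3)"
    have B: "4 \<le> B" "exp (real q + 3) \<le> B" "exp ((real p + real n\<^sub>0) / \<tau>\<^sub>1) \<le> B"
      "exp ((real p + real q) / \<tau>\<^sub>2) \<le> B" "M * a' + 1 \<le> B" "a' \<le> B" "2 * a \<le> B"
      by (rule order_trans[OF Max_ge B\<^sub>0[unfolded B\<^sub>0_def]], simp, simp)+
    have ln_ge: "y \<le> ln B" if "exp y \<le> B" for y
      using that B(1) by (simp add: ln_ge_iff)
    have L: "real q + 3 \<le> ln B" "real p + real n\<^sub>0 \<le> \<tau>\<^sub>1 * ln B" "real p + real q \<le> \<tau>\<^sub>2 * ln B"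
      using ln_ge[OF B(2)] ln_ge[OF B(3)] ln_ge[OF B(4)] \<tau> by (simp_all add: field_simps)
    define t\<^sub>1 where "t\<^sub>1 = nat \<lceil>\<tau>\<^sub>1 * ln B\<rceil>"
    define t\<^sub>2 where "t\<^sub>2 = nat \<lceil>\<tau>\<^sub>2 * ln B\<rceil>"
    have t: "\<tau>\<^sub>1 * ln B \<le> t\<^sub>1" "t\<^sub>1 \<le> \<tau>\<^sub>1 * ln B + 1" "\<tau>\<^sub>2 * ln B \<le> t\<^sub>2" "t\<^sub>2 \<le> \<tau>\<^sub>2 * ln B + 1"
      using L unfolding t\<^sub>1_def t\<^sub>2_def by linarith+
    have n_bounds: "C\<^sub>2 * ln B - 1 \<le> n" "n \<le> C\<^sub>2 * ln B"
      using L C unfolding n by (auto intro!: mult_nonneg_nonneg)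
    have "C\<^sub>2 * ln B = \<tau>\<^sub>1 * ln B + \<tau>\<^sub>2 * ln B + ln B"
      by (simp add: C\<^sub>2_def algebra_simps)
    then have "real (t\<^sub>1 + t\<^sub>2 + q) \<le> n" "real n\<^sub>0 \<le> n" "real p \<le> t\<^sub>1" "real p \<le> t\<^sub>2" "real q \<le> t\<^sub>2"
      using t L n_bounds by (simp_all del: of_nat_le_iff)
    then have nat_le: "t\<^sub>1 + t\<^sub>2 + q \<le> n" "n\<^sub>0 \<le> n" "p \<le> t\<^sub>1" "p \<le> t\<^sub>2" "q \<le> t\<^sub>2"
      by simp_all
    have close: "D * B * l ^ (s - p) \<le> E * B powr (1 - \<Lambda> * \<tau>)"
      if "\<tau> * ln B \<le> s" "p \<le> s" for s \<tau>
    proof -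
      have "D * B * l ^ (s - p) = E * B * l ^ s"
        using that l by (simp add: E_def power_diff divide_inverse)
      also have "\<dots> \<le> E * B * B powr (ln l * \<tau>)"
        by (intro mult_left_mono power_le_powr) (use that l B E in auto)
      also have "\<dots> = E * B powr (1 - \<Lambda> * \<tau>)"
        using B by (simp add: \<Lambda>_def powr_diff powr_minus powr_add divide_inverse)
      finally show ?thesis .
    qed
    have close\<^sub>1: "D * B * l ^ (t\<^sub>1 - p) \<le> E * B powr (- G)"
      using close[OF t(1) nat_le(3)] \<Lambda> by (simp add: \<tau>\<^sub>1_def)
    have close\<^sub>2: "D * B * l ^ (t\<^sub>2 - p) \<le> E * B powr (- \<gamma> - 1)"
      proof -
      have "1 - \<Lambda> * \<tau>\<^sub>2 = - \<gamma> - 1" using \<Lambda> by (simp add: \<tau>\<^sub>2_def)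
      then show ?thesis using close[OF t(3) nat_le(4)] by (simp only:)
    qed
    have powr_mono': "B powr x \<le> B powr y" if "x \<le> y" for x y
      using that B by (intro powr_mono) auto
    have exp_n: "exp (\<Phi> * n) \<le> B powr (\<Phi> * C\<^sub>2)"
      using mult_left_mono[OF n_bounds(2) \<open>0 \<le> \<Phi>\<close>] B by (simp add: powr_def mult.assoc)
    have exp_t\<^sub>2: "exp (\<Phi> * t\<^sub>2) \<le> exp \<Phi> * B powr (\<Phi> * \<tau>\<^sub>2)"
      using mult_left_mono[OF t(4) \<open>0 \<le> \<Phi>\<close>] B
      by (simp add: powr_def mult.assoc exp_add[symmetric] distrib_left add.commute)
    define \<epsilon>' where "\<epsilon>' = \<epsilon> + sqrt (2 * \<epsilon> * exp (\<Phi> * n)) + D * B * l ^ (t\<^sub>1 - p)"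
    define \<kappa> where "\<kappa> = 3 * sqrt (2 * \<epsilon>' * exp (\<Phi> * t\<^sub>2)) + 2 * (D * B * l ^ (t\<^sub>2 - p))"
    have "0 \<le> \<epsilon>'"
      unfolding \<epsilon>'_def using \<open>0 \<le> D\<close> B(1) l(1) by (intro add_nonneg_nonneg) (simp_all add: \<epsilon>)
    have "\<epsilon> \<le> B powr (- G)"
    proof -
      have "0 \<le> \<Phi> * C\<^sub>2" using \<open>0 \<le> \<Phi>\<close> C by simp
      then have "- C\<^sub>3 \<le> - G" using G unfolding C\<^sub>3_def by linarith
      then show ?thesis unfolding \<epsilon> by (rule powr_mono')
    qed
    moreover have "sqrt (2 * \<epsilon> * exp (\<Phi> * n)) \<le> 2 * B powr (- G)"
    proof (rule real_le_lsqrt)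
      have "2 * \<epsilon> * exp (\<Phi> * n) \<le> 2 * \<epsilon> * B powr (\<Phi> * C\<^sub>2)"
        using exp_n by (intro mult_left_mono) (auto simp: \<epsilon>)
      also have "\<dots> = 2 * (B powr (- G))\<^sup>2"
        by (simp add: \<epsilon> C\<^sub>3_def power2_eq_square powr_add[symmetric])
      also have "\<dots> \<le> (2 * B powr (- G))\<^sup>2"
        by (simp add: power_mult_distrib)
      finally show "2 * \<epsilon> * exp (\<Phi> * n) \<le> (2 * B powr (- G))\<^sup>2" .
    qed auto
    ultimately have \<epsilon>'_le: "\<epsilon>' \<le> a * B powr (- G)"
      using close\<^sub>1 by (simp add: \<epsilon>'_def a_def algebra_simps)
    have inv_B: "B powr (- G) \<le> inverse B"
      using powr_mono'[of "- G" "-1"] G B by (simp add: powr_minus)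
    have "\<epsilon>' \<le> a * inverse B"
      using \<epsilon>'_le mult_left_mono[OF inv_B, of a] a by linarith
    also have "\<dots> \<le> 1 / 2" using B by (simp add: field_simps)
    finally have \<epsilon>'_half: "\<epsilon>' \<le> 1 / 2" .
    have "inverse B \<le> inverse 4" using B by (intro le_imp_inverse_le) auto
    then have "\<epsilon> \<le> 1 / 4" using \<open>\<epsilon> \<le> B powr (- G)\<close> inv_B by simp
    have "sqrt (2 * \<epsilon>' * exp (\<Phi> * t\<^sub>2)) \<le> sqrt (2 * a * exp \<Phi> * (B powr (- \<gamma> - 1))\<^sup>2)"
    proof (rule real_sqrt_le_mono)
      have "2 * \<epsilon>' * exp (\<Phi> * t\<^sub>2) \<le> 2 * (a * B powr (- G)) * (exp \<Phi> * B powr (\<Phi> * \<tau>\<^sub>2))"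
        using \<epsilon>'_le exp_t\<^sub>2 a \<open>0 \<le> \<epsilon>'\<close> by (intro mult_mono) auto
      also have "\<dots> = 2 * a * exp \<Phi> * (B powr (- G) * B powr (\<Phi> * \<tau>\<^sub>2))"
        by simp
      also have "B powr (- G) * B powr (\<Phi> * \<tau>\<^sub>2) = (B powr (- \<gamma> - 1))\<^sup>2"
        by (simp add: G_def power2_eq_square powr_add[symmetric])
      finally show "2 * \<epsilon>' * exp (\<Phi> * t\<^sub>2) \<le> 2 * a * exp \<Phi> * (B powr (- \<gamma> - 1))\<^sup>2" .
    qed
    also have "\<dots> = sqrt (2 * a * exp \<Phi>) * B powr (- \<gamma> - 1)"
      using a by (simp add: real_sqrt_mult)
    finally have \<kappa>_le: "\<kappa> \<le> a' * B powr (- \<gamma> - 1)"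
      using close\<^sub>2 by (simp add: \<kappa>_def a'_def algebra_simps)
    have a': "0 \<le> a'" using a E by (simp add: a'_def)
    have "a' * B powr (- \<gamma> - 1) \<le> a' * inverse B"
      using powr_mono'[of "- \<gamma> - 1" "-1"] B a' \<open>0 \<le> \<gamma>\<close>
      by (intro mult_left_mono) (auto simp: powr_minus)
    also have "\<dots> \<le> 1" using B by (simp add: field_simps)
    finally have "\<kappa> \<le> 1" using \<kappa>_le by simp
    have "M * \<kappa> \<le> M * a' * B powr (- \<gamma> - 1)"
      using mult_left_mono[OF \<kappa>_le \<open>0 \<le> M\<close>] by (simp add: mult.assoc)
    also have "\<dots> < B * B powr (- \<gamma> - 1)"
      using B by (intro mult_strict_right_mono) auto
    also have "\<dots> = B powr (- \<gamma>)"
      using B powr_mult_base[of B "- \<gamma> - 1"] by simp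
    finally have "M * \<kappa> < B powr (- \<gamma>)" .
    show ?thesis
      unfolding admissible_scales_def n[symmetric] \<epsilon>[symmetric]
      by (intro conjI exI[of _ t\<^sub>1] exI[of _ t\<^sub>2] exI[of _ \<epsilon>'] exI[of _ \<kappa>]) fact+
  qed
  moreover have "1 \<le> B\<^sub>0" unfolding B\<^sub>0_def by (simp add: Max_ge_iff)
  ultimately show ?thesis
    using C by (intro exI[of _ C\<^sub>2] exI[of _ C\<^sub>3] exI[of _ B\<^sub>0] conjI allI impI) (assumption | simp)+
qed

section \<open>Contraction of the twisted operators\<close>

lemma birkhoff_sum_twist:
  fixes \<Theta> :: "(nat \<Rightarrow> 'k) \<Rightarrow> real^'d"
  shows "birkhoff_sum (\<lambda>x. - b * r x + int_dot m (\<Theta> x)) n x =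
    - b * birkhoff_sum r n x + int_dot m (birkhoff_sum \<Theta> n x)"
  by (simp only: birkhoff_sum_def sum.distrib sum_distrib_left int_dot_sum)

theorem proposition3p5:
  fixes A :: "nat^'k^'k"
    and l :: real
    and \<phi> r :: "(nat \<Rightarrow> 'k) \<Rightarrow> real"
    and \<Theta> :: "(nat \<Rightarrow> 'k) \<Rightarrow> real^'d"
  assumes "zero_one_matrix A" and "aperiodic A"
    and "1/2 \<le> l" and "l < 1"
    and "shift_Lipschitz A l r" and "\<forall>x\<in>subshift A. r x > 0"
    and "shift_Lipschitz A l \<Theta>"
    and "shift_Lipschitz A l \<phi>"
    and "\<forall>x\<in>subshift A. transfer_op A (\<lambda>y. of_real (\<phi> y)) (\<lambda>y. 1) x = 1"
    and "\<exists>x1\<in>subshift A. \<exists>x2\<in>subshift A. \<exists>x3\<in>subshift A. \<exists>N'>0.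
           (left_shift ^^ N') x1 = x1 \<and> (left_shift ^^ N') x2 = x2 \<and> (left_shift ^^ N') x3 = x3 \<and>
           birkhoff_sum r N' x2 \<noteq> birkhoff_sum r N' x3 \<and>
           (let \<alpha>' = (birkhoff_sum r N' x1 - birkhoff_sum r N' x2) /
                     (birkhoff_sum r N' x2 - birkhoff_sum r N' x3);
                \<beta>' = (1 / (2 * pi)) *\<^sub>R (birkhoff_sum \<Theta> N' x1 - birkhoff_sum \<Theta> N' x2)
                     - (1 / (2 * pi) * \<alpha>') *\<^sub>R (birkhoff_sum \<Theta> N' x2 - birkhoff_sum \<Theta> N' x3)
            in inhom_diophantine \<alpha>' \<beta>')"
  shows "\<exists>C0\<ge>1. \<forall>C1\<ge>C0. \<exists>C2>0. \<exists>C3>0. \<exists>C4>0.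
           \<forall>(b::real) (m::int^'d). m \<noteq> 0 \<longrightarrow>
             (\<forall>h\<in>Lip_space A l.
                weighted_norm A l C4 (b_weight C1 b m)
                  ((twisted_op A \<phi> r \<Theta> b m ^^ nat \<lfloor>C2 * ln (b_weight C1 b m)\<rfloor>) h)
                \<le> (1 - b_weight C1 b m powr (- C3)) * weighted_norm A l C4 (b_weight C1 b m) h)"
proof -
  have l: "0 < l" "l < 1" using assms(3,4) by auto
  obtain p where p: "connecting_gap A p"
    using aperiodic_connecting_gap assms(1,2) by blast
  obtain L\<^sub>r where L\<^sub>r: "L\<^sub>r > 0"
    "\<And>x y. x \<in> subshift A \<Longrightarrow> y \<in> subshift A \<Longrightarrow> norm (r x - r y) \<le> L\<^sub>r * shift_dist l x y"
    using shift_Lipschitz_bound[OF l assms(5)] by blast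
  obtain L\<^sub>\<Theta> where L\<^sub>\<Theta>: "L\<^sub>\<Theta> > 0"
    "\<And>x y. x \<in> subshift A \<Longrightarrow> y \<in> subshift A \<Longrightarrow> norm (\<Theta> x - \<Theta> y) \<le> L\<^sub>\<Theta> * shift_dist l x y"
    using shift_Lipschitz_bound[OF l assms(7)] by blast
  obtain L\<^sub>\<phi> where L\<^sub>\<phi>: "L\<^sub>\<phi> > 0"
    "\<And>x y. x \<in> subshift A \<Longrightarrow> y \<in> subshift A \<Longrightarrow> norm (\<phi> x - \<phi> y) \<le> L\<^sub>\<phi> * shift_dist l x y"
    using shift_Lipschitz_bound[OF l assms(8)] by blast
  obtain x\<^sub>1 x\<^sub>2 x\<^sub>3 q where x: "x\<^sub>1 \<in> subshift A" "x\<^sub>2 \<in> subshift A" "x\<^sub>3 \<in> subshift A"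
    "(left_shift ^^ q) x\<^sub>1 = x\<^sub>1" "(left_shift ^^ q) x\<^sub>2 = x\<^sub>2" "(left_shift ^^ q) x\<^sub>3 = x\<^sub>3"
    and R_neq: "birkhoff_sum r q x\<^sub>2 \<noteq> birkhoff_sum r q x\<^sub>3"
    and dioph: "let \<alpha>' = (birkhoff_sum r q x\<^sub>1 - birkhoff_sum r q x\<^sub>2) /
                     (birkhoff_sum r q x\<^sub>2 - birkhoff_sum r q x\<^sub>3);
                \<beta>' = (1 / (2 * pi)) *\<^sub>R (birkhoff_sum \<Theta> q x\<^sub>1 - birkhoff_sum \<Theta> q x\<^sub>2)
                     - (1 / (2 * pi) * \<alpha>') *\<^sub>R (birkhoff_sum \<Theta> q x\<^sub>2 - birkhoff_sum \<Theta> q x\<^sub>3)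
            in inhom_diophantine \<alpha>' \<beta>'"
    using assms(10) by blast
  define \<alpha> where "\<alpha> = (birkhoff_sum r q x\<^sub>1 - birkhoff_sum r q x\<^sub>2) /
                     (birkhoff_sum r q x\<^sub>2 - birkhoff_sum r q x\<^sub>3)"
  define \<beta> where "\<beta> = (1 / (2 * pi)) *\<^sub>R (birkhoff_sum \<Theta> q x\<^sub>1 - birkhoff_sum \<Theta> q x\<^sub>2)
                     - (1 / (2 * pi) * \<alpha>) *\<^sub>R (birkhoff_sum \<Theta> q x\<^sub>2 - birkhoff_sum \<Theta> q x\<^sub>3)"
  have "inhom_diophantine \<alpha> \<beta>"
    using dioph unfolding \<alpha>_def \<beta>_def Let_def .
  then obtain c \<gamma> where c: "c > 0" "\<gamma> > 0"
    "\<And>(p::int) (q::int) (m::int^'d). (q, m) \<noteq> (0, 0) \<Longrightarrow>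
        c * (\<bar>of_int q\<bar> + int_l1 m) powr (- \<gamma>) \<le> \<bar>of_int q * \<alpha> + int_dot m \<beta> - of_int p\<bar>"
    unfolding inhom_diophantine_def by blast

  \<comment> \<open>The space has diameter at most 1, so one value and the Lipschitz constant bound
    \<open>\<phi>\<close> from below.\<close>
  define \<Phi> where "\<Phi> = \<bar>\<phi> x\<^sub>1\<bar> + L\<^sub>\<phi>"
  have \<Phi>: "0 \<le> \<Phi>" using L\<^sub>\<phi> by (simp add: \<Phi>_def)
  have \<phi>_ge: "- \<Phi> \<le> \<phi> x" if "x \<in> subshift A" for x
  proof -
    have "\<bar>\<phi> x - \<phi> x\<^sub>1\<bar> \<le> L\<^sub>\<phi> * 1"
      using L\<^sub>\<phi>(2)[OF that x(1)] mult_left_mono[OF shift_dist_le_1[OF l, of x x\<^sub>1], of L\<^sub>\<phi>] L\<^sub>\<phi>(1)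
      by (simp only: real_norm_def) linarith
    then show ?thesis by (simp add: \<Phi>_def)
  qed
  \<comment> \<open>\<open>L * B\<close> will dominate the Lipschitz constants of
    \<open>\<phi>\<close> and \<open>\<omega>\<close>, and \<open>K\<^sub>0 * B\<close> will
    dominate \<open>K\<close>. The 2 in \<open>C4\<close> lets the Lasota-Yorke error use only half
    of the bound \<open>C4 * B\<close>.\<close>
  define L where "L = L\<^sub>\<phi> + L\<^sub>r + L\<^sub>\<Theta>"
  define K\<^sub>0 where "K\<^sub>0 = 2 * CARD('k) * L + 2"
  define C4 where "C4 = 2 * K\<^sub>0 / (1 - l)"
  have "0 < L" "0 < K\<^sub>0" using L\<^sub>\<phi> L\<^sub>r L\<^sub>\<Theta> by (auto simp: L_def K\<^sub>0_def add_pos_pos)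
  then have C4: "0 < C4" using l by (simp add: C4_def)
  define M\<^sub>0 where "M\<^sub>0 = \<bar>birkhoff_sum r q x\<^sub>2\<bar> + \<bar>birkhoff_sum r q x\<^sub>3\<bar> + norm (birkhoff_sum \<Theta> q x\<^sub>2)
      + norm (birkhoff_sum \<Theta> q x\<^sub>3) + 3"
  have M\<^sub>0: "0 < M\<^sub>0" by (simp add: M\<^sub>0_def add_nonneg_pos)
  \<comment> \<open>Chosen so that the conclusion of \<open>diophantine_phase_gap\<close> becomes
    \<open>B powr (- \<gamma>) \<le> M * \<kappa>\<close>.\<close>
  define M where "M = 2 * (1 + \<bar>\<alpha>\<bar>) / (c * M\<^sub>0 powr (- \<gamma>))"
  have M: "0 \<le> M" using c by (simp add: M_def)
  obtain n\<^sub>0 where n\<^sub>0: "l ^ n\<^sub>0 < 1 / 4" using real_arch_pow_inv[of "1 / 4" l] l by auto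
  obtain C2 C3 B\<^sub>0 where C2: "0 < C2" and C3: "0 < C3" and B\<^sub>0: "1 \<le> B\<^sub>0"
    and scales: "\<And>B. B\<^sub>0 \<le> B \<Longrightarrow> n\<^sub>0 \<le> nat \<lfloor>C2 * ln B\<rfloor> \<and> B powr (- C3) \<le> 1 / 4 \<and>
      admissible_scales l \<Phi> C4 \<gamma> M p q B (nat \<lfloor>C2 * ln B\<rfloor>) (B powr (- C3))"
    using logarithmic_scales[OF l \<Phi> less_imp_le[OF C4] less_imp_le[OF c(2)] M, of n\<^sub>0 p q] by blast

  have main: "weighted_norm A l C4 B ((twisted_op A \<phi> r \<Theta> b m ^^ nat \<lfloor>C2 * ln B\<rfloor>) h)
      \<le> (1 - B powr (- C3)) * weighted_norm A l C4 B h"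
    if "B\<^sub>0 \<le> C1" and m: "m \<noteq> 0" and h: "h \<in> Lip_space A l" and B_def: "B = b_weight C1 b m" for C1 b m h B
  proof -
    have l1: "1 \<le> int_l1 m" using m by (rule int_l1_ge_1)
    have C1: "1 \<le> C1" using that(1) B\<^sub>0 by simp
    have "C1 * 1 \<le> C1 * int_l1 m" "1 * int_l1 m \<le> C1 * int_l1 m"
      using C1 l1 by (auto intro!: mult_left_mono mult_right_mono)
    then have B: "B\<^sub>0 \<le> B" "1 \<le> B" "\<bar>b\<bar> \<le> B" "int_l1 m \<le> B"
      using that(1) B\<^sub>0 l1 unfolding B_def b_weight_def by linarith+
    define \<omega> where "\<omega> = (\<lambda>x. - b * r x + int_dot m (\<Theta> x))"
    interpret twisted_shift A l \<phi> \<omega> \<Phi> "L * B"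
    proof
      fix x y assume X: "x \<in> subshift A" "y \<in> subshift A"
      have d: "0 \<le> shift_dist l x y" using l(1) by (rule shift_dist_nonneg)
      have "L\<^sub>\<phi> * 1 \<le> L * B"
        using L\<^sub>\<phi>(1) L\<^sub>r(1) L\<^sub>\<Theta>(1) B by (intro mult_mono) (auto simp: L_def)
      from mult_right_mono[OF this d] show "\<bar>\<phi> x - \<phi> y\<bar> \<le> L * B * shift_dist l x y"
        using L\<^sub>\<phi>(2)[OF X] by simp
      have "\<omega> x - \<omega> y = - b * (r x - r y) + int_dot m (\<Theta> x - \<Theta> y)"
        by (simp add: \<omega>_def int_dot_diff algebra_simps)
      also have "\<bar>\<dots>\<bar> \<le> \<bar>b\<bar> * norm (r x - r y) + int_l1 m * norm (\<Theta> x - \<Theta> y)"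
        using int_dot_le[of m "\<Theta> x - \<Theta> y"] abs_mult[of b "r x - r y"] by simp
      also have "\<dots> \<le> B * (L\<^sub>r * shift_dist l x y) + B * (L\<^sub>\<Theta> * shift_dist l x y)"
        by (intro add_mono mult_mono L\<^sub>r L\<^sub>\<Theta> X) (use B in auto)
      also have "\<dots> = (L\<^sub>r + L\<^sub>\<Theta>) * B * shift_dist l x y" by (simp add: algebra_simps)
      also have "\<dots> \<le> L * B * shift_dist l x y"
        by (intro mult_right_mono d) (use B L\<^sub>\<phi>(1) in \<open>auto simp: L_def\<close>)
      finally show "\<bar>\<omega> x - \<omega> y\<bar> \<le> L * B * shift_dist l x y" .
    qed (use l \<Phi> \<phi>_ge assms(9) \<open>0 < L\<close> B in auto)
    have T_eq: "twisted_op A \<phi> r \<Theta> b m = T"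
    proof -
      have "(\<lambda>x. of_real (\<phi> x) - \<i> * of_real (b * r x) + \<i> * of_real (int_dot m (\<Theta> x))) = \<psi>"
        by (simp add: fun_eq_iff \<psi>_def) (simp add: \<omega>_def algebra_simps)
      then show ?thesis by (simp add: twisted_op_def)
    qed
    have "K \<le> K\<^sub>0 * B" using B unfolding K_def K\<^sub>0_def by (simp add: algebra_simps)
    moreover have "(1 - l) * (C4 * B) = 2 * (K\<^sub>0 * B)" using l by (simp add: C4_def)
    ultimately have K: "2 * K \<le> (1 - l) * (C4 * B)" by linarith
    define n where "n = nat \<lfloor>C2 * ln B\<rfloor>"
    define \<epsilon> where "\<epsilon> = B powr (- C3)"
    obtain t\<^sub>1 t\<^sub>2 \<epsilon>' \<kappa> where n: "n\<^sub>0 \<le> n" and \<epsilon>: "\<epsilon> \<le> 1 / 4"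
      and t: "p \<le> t\<^sub>1" "p \<le> t\<^sub>2" "q \<le> t\<^sub>2" "t\<^sub>1 + t\<^sub>2 + q \<le> n"
      and \<epsilon>': "\<epsilon>' = \<epsilon> + sqrt (2 * \<epsilon> * exp (\<Phi> * n)) + C4 * B * l ^ (t\<^sub>1 - p)" "\<epsilon>' \<le> 1 / 2"
      and \<kappa>: "\<kappa> = 3 * sqrt (2 * \<epsilon>' * exp (\<Phi> * t\<^sub>2)) + 2 * (C4 * B * l ^ (t\<^sub>2 - p))" "\<kappa> \<le> 1"
        "M * \<kappa> < B powr (- \<gamma>)"
      using scales[OF B(1), folded n_def \<epsilon>_def] unfolding admissible_scales_def by blast
    have \<epsilon>_pos: "0 < \<epsilon>" using B by (simp add: \<epsilon>_def)
    have CB: "0 < C4 * B" using C4 B by simp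

    \<comment> \<open>The contradiction argument, run on the unit ball of the weighted norm; general
      \<open>h\<close> follows by scaling.\<close>
    have sup_small: "norm ((T ^^ n) g x) \<le> 1 - \<epsilon>"
      if g: "lip_bounded A l g 1 (C4 * B)" and "x \<in> subshift A" for g x
    proof (rule ccontr)
      assume "\<not> ?thesis"
      then have large: "1 - \<epsilon> \<le> norm ((T ^^ n) g x)" by simp
      have "lip_bounded A l ((T ^^ k) g) 1 (C4 * B)" for k
        by (rule lip_bounded_funpow_T_invariant[OF g]) (use CB K K_nonneg in auto)
      note aligned = periodic_phases_aligned[OF this _ p that(2) large _ t \<epsilon>', folded \<kappa>(1)]
      have phase: "birkhoff_sum \<omega> q z = - b * birkhoff_sum r q z + int_dot m (birkhoff_sum \<Theta> q z)" for z
        unfolding \<omega>_def by (rule birkhoff_sum_twist)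
      have "c * (M\<^sub>0 * B) powr (- \<gamma>) \<le> 2 * \<kappa> * (1 + \<bar>\<alpha>\<bar>)"
        unfolding M\<^sub>0_def
      proof (rule diophantine_phase_gap[OF \<alpha>_def R_neq \<beta>_def, where b = b])
        show "c * (\<bar>of_int q'\<bar> + int_l1 m) powr (- \<gamma>)
            \<le> \<bar>of_int q' * \<alpha> + int_dot m \<beta> - of_int p'\<bar>" for p' q' :: int
          using m by (intro c(3)) simp
        show "norm (cis (birkhoff_sum \<omega> q x\<^sub>1) - cis (birkhoff_sum \<omega> q x\<^sub>2)) \<le> 4 * \<kappa>"
          "norm (cis (birkhoff_sum \<omega> q x\<^sub>2) - cis (birkhoff_sum \<omega> q x\<^sub>3)) \<le> 4 * \<kappa>"
          using x CB \<epsilon>_pos by (auto intro!: aligned)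
      qed (use m c(1,2) \<kappa>(2) B phase in simp_all)
      then have "B powr (- \<gamma>) * (c * M\<^sub>0 powr (- \<gamma>)) \<le> \<kappa> * (2 * (1 + \<bar>\<alpha>\<bar>))"
        using M\<^sub>0 B(2) by (simp add: powr_mult mult_ac)
      moreover have "0 < c * M\<^sub>0 powr (- \<gamma>)" using c(1) M\<^sub>0 by simp
      ultimately have "B powr (- \<gamma>) \<le> \<kappa> * (2 * (1 + \<bar>\<alpha>\<bar>)) / (c * M\<^sub>0 powr (- \<gamma>))"
        by (simp only: pos_le_divide_eq)
      also have "\<dots> = M * \<kappa>" by (simp add: M_def)
      finally have "B powr (- \<gamma>) \<le> M * \<kappa>" .
      then show False using \<kappa>(3) by simp
    qed

    define W where "W = weighted_norm A l C4 B h"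
    have hW: "lip_bounded A l h W (C4 * B * W)"
      unfolding W_def by (rule lip_bounded_weighted_norm[OF l h C4]) (use B in auto)
    have "0 \<le> W"
      using hW x(1) norm_ge_zero[of "h x\<^sub>1"] unfolding lip_bounded_def by (meson order_trans)
    have "lip_bounded A l ((T ^^ n) h) W (l ^ n * (C4 * B * W) + K * W / (1 - l))"
      by (rule lip_bounded_funpow_T[OF hW]) (use \<open>0 \<le> W\<close> CB in auto)
    moreover have "l ^ n * (C4 * B * W) + K * W / (1 - l) \<le> C4 * B * ((1 - \<epsilon>) * W)"
    proof -
      \<comment> \<open>The old Lipschitz part keeps at most 1/4, the error term takes at most 1/2,
        and \<open>\<epsilon> \<le> 1 / 4\<close> leaves room for the sum.\<close>
      have "l ^ n \<le> l ^ n\<^sub>0" using n l by (intro power_decreasing) auto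
      then have "l ^ n * (C4 * B * W) \<le> 1 / 4 * (C4 * B * W)"
        by (intro mult_right_mono) (use n\<^sub>0 \<open>0 \<le> W\<close> CB in auto)
      moreover have "K * W / (1 - l) \<le> 1 / 2 * (C4 * B * W)"
        using mult_right_mono[OF K \<open>0 \<le> W\<close>] l by (simp add: field_simps)
      moreover have "3 / 4 * (C4 * B * W) \<le> (1 - \<epsilon>) * (C4 * B * W)"
        by (intro mult_right_mono) (use \<epsilon> \<open>0 \<le> W\<close> CB in auto)
      ultimately show ?thesis by (simp add: algebra_simps)
    qed
    moreover have "norm ((T ^^ n) h x) \<le> (1 - \<epsilon>) * W" if "x \<in> subshift A" for x
    proof (cases "W = 0")
      \<comment> \<open>A function of norm 0 cannot be rescaled, but then both sides vanish.\<close>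
      case True
      then show ?thesis using calculation(1) that by (simp add: lip_bounded_def)
    next
      case False
      then have "0 < W" using \<open>0 \<le> W\<close> by simp
      let ?g = "\<lambda>y. of_real (inverse W) * h y"
      have "norm (?g x - ?g y) \<le> C4 * B * shift_dist l x y" "norm (?g x) \<le> 1"
        if "x \<in> subshift A" "y \<in> subshift A" for x y
      proof -
        have "norm (h x - h y) \<le> C4 * B * W * shift_dist l x y" "norm (h x) \<le> W"
          using hW that by (auto simp: lip_bounded_def)
        moreover have "?g x - ?g y = of_real (inverse W) * (h x - h y)"
          by (simp add: algebra_simps)
        ultimately show "norm (?g x - ?g y) \<le> C4 * B * shift_dist l x y" "norm (?g x) \<le> 1"
          using \<open>0 < W\<close> by (simp_all add: norm_divide field_simps)
      qed
      then have "norm ((T ^^ n) ?g x) \<le> 1 - \<epsilon>"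
        by (intro sup_small that) (auto simp: lip_bounded_def)
      then have "norm ((T ^^ n) h x) / W \<le> 1 - \<epsilon>"
        using \<open>0 < W\<close> unfolding funpow_transfer_op_scale[OF that]
        by (simp add: norm_mult norm_inverse divide_inverse mult.commute)
      then show ?thesis using \<open>0 < W\<close> by (simp add: pos_divide_le_eq)
    qed
    ultimately have "lip_bounded A l ((T ^^ n) h) ((1 - \<epsilon>) * W) (C4 * B * ((1 - \<epsilon>) * W))"
      using lip_bounded_mono[OF _ l(1) order_refl] unfolding lip_bounded_def by blast
    then have "weighted_norm A l C4 B ((T ^^ n) h) \<le> (1 - \<epsilon>) * W"
      by (rule weighted_norm_le[OF l(1)]) (use x(1) C4 B \<epsilon> \<open>0 \<le> W\<close> in auto)
    then show ?thesis by (simp add: T_eq n_def \<epsilon>_def W_def)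
  qed
  show ?thesis
  \<comment> \<open>As \<open>int_l1 m \<ge> 1\<close>, taking \<open>C1 \<ge> B\<^sub>0\<close>
    forces every \<open>b_weight C1 b m\<close> above the threshold. \<open>C2\<close>,
    \<open>C3\<close> and \<open>C4\<close> were fixed before \<open>C1\<close>, so they do not
    depend on it.\<close>
  proof (rule exI[of _ B\<^sub>0], intro conjI B\<^sub>0 allI impI)
    fix C1 assume "B\<^sub>0 \<le> C1"
    then show "\<exists>C2>0. \<exists>C3>0. \<exists>C4>0. \<forall>(b::real) (m::int^'d). m \<noteq> 0 \<longrightarrow>
             (\<forall>h\<in>Lip_space A l.
                weighted_norm A l C4 (b_weight C1 b m)
                  ((twisted_op A \<phi> r \<Theta> b m ^^ nat \<lfloor>C2 * ln (b_weight C1 b m)\<rfloor>) h)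
                \<le> (1 - b_weight C1 b m powr (- C3)) * weighted_norm A l C4 (b_weight C1 b m) h)"
      using main C2 C3 C4 by blast
  qed
qed

end
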